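(* Let $\ell\in\{1,2,3,\dots\}$. Then for each choice of sign $\pm$, all $r\in(0,+\infty)$ and all $f,g\in\mathcal{H}_\ell$, \[ \left(\int_{-\pi}^{\pi}\int_{-\pi}^{\pi}\left|\langle f,\pi_\ell^{\pm}(\tilde k_{\theta_1}\tilde a_r\tilde k_{\theta_2})g\rangle_\ell\right|^2\,\mathrm{d}\theta_1\,\mathrm{d}\theta_2\right)^{1/2}\le(\cosh r)^{-1}\,\|f\|_{\mathcal{H}_\ell}\|g\|_{\mathcal{H}_\ell}. \]
   Context: Let $G=\mathrm{SU}(1,1)$ (a conjugate of $\mathrm{SL}(2,\mathbb{R})$ in $\mathrm{SL}(2,\mathbb{C})$), consisting of the matrices $x=\begin{pmatrix}\alpha&\beta\\\bar\beta&\bar\alpha\end{pmatrix}$ with $\alpha,\beta\in\mathbb{C}$, $|\alpha|^2-|\beta|^2=1$. Let $D=\{z\in\mathbb{C}:|z|<1\}$ and let $\sigma$ be Lebesgue measure on $\mathbb{C}$. For $\ell\in\{1,2,3,\dots\}$, $\mathcal{H}_\ell$ is the Hilbert space of holomorphic functions on $D$ with finite norm for the inner product (conjugate-linear in the first variable) \[ \langle f,g\rangle_\ell=\frac{\ell-1}{\pi}\int_D(1-|z|^2)^{\ell-2}\,\overline{f(z)}\,g(z)\,\mathrm{d}\sigma(z)\quad(\ell>1), \] \[ \langle f,g\rangle_1=\lim_{\ell\to1+}\frac{\ell-1}{\pi}\int_D(1-|z|^2)^{\ell-2}\,\overline{f(z)}\,g(z)\,\mathrm{d}\sigma(z)\quad(\ell=1).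 \] The discrete series representations $\pi_\ell^\pm$ of $G$ on $\mathcal{H}_\ell$ are \[ \pi_\ell^{\pm}(x)f(z)=\mu^{\pm}(x,x^{-1}z)^\ell f(x^{-1}z)\qquad(x\in G,\ z\in D), \] where for $\pi_\ell^+$ the action of $G$ on $D$ is $xz=\dfrac{\bar\alpha z+\bar\beta}{\beta z+\alpha}$ and $\mu^+(x,z)=\beta z+\alpha$, while for $\pi_\ell^-$ the action of $G$ on $D$ is $xz=\dfrac{\alpha z+\beta}{\bar\beta z+\bar\alpha}$ and $\mu^-(x,z)=\bar\beta z+\bar\alpha$. For $r,\theta\in\mathbb{R}$, \[ \tilde a_r=\begin{pmatrix}\cosh r&\sinh r\\\sinh r&\cosh r\end{pmatrix},\qquad\tilde k_\theta=\begin{pmatrix}e^{-i\theta}&0\\0&e^{i\theta}\end{pmatrix}. \]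
   Formalization: Both angle integrals are taken with the normalised measure dθ/(2π), giving a factor 1/(2π)² under the root; with plain dθ₁dθ₂ the bound fails, e.g. for ℓ=1 and f=g=1, where the left side is 2π/cosh r and the right side is 1/cosh r. *)

theory Defs
  imports "HOL-Complex_Analysis.Complex_Analysis"
begin

section \<open>The group SU(1,1)\<close>

definition su11_matrix :: "complex \<Rightarrow> complex \<Rightarrow> complex^2^2" where
  "su11_matrix \<alpha> \<beta> = vector [vector [\<alpha>, \<beta>], vector [cnj \<beta>, cnj \<alpha>]]"

definition SU11 :: "(complex^2^2) set" where
  "SU11 = {su11_matrix \<alpha> \<beta> | \<alpha> \<beta>. (cmod \<alpha>)\<^sup>2 - (cmod \<beta>)\<^sup>2 = 1}"

definition a_tilde :: "real \<Rightarrow> complex^2^2" where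
  "a_tilde r = vector [vector [complex_of_real (cosh r), complex_of_real (sinh r)],
                       vector [complex_of_real (sinh r), complex_of_real (cosh r)]]"

definition k_tilde :: "real \<Rightarrow> complex^2^2" where
  "k_tilde \<theta> = vector [vector [exp (- (\<i> * complex_of_real \<theta>)), 0],
                       vector [0, exp (\<i> * complex_of_real \<theta>)]]"

text \<open>The rotations \<open>k_tilde \<theta>\<close>, \<open>-\<pi> \<le> \<theta> \<le> \<pi>\<close>, run once through a compact subgroup. Integration
  over it is taken with respect to the Haar probability measure \<open>d\<theta> / (2\<pi>)\<close>. The estimate with
  constant 1 fails for the unnormalised \<open>d\<theta>\<close>: for \<open>f = g = 1\<close> the matrix coefficient has
  modulus \<open>(cosh r)\<close> to the power \<open>-\<ell>\<close> for all angles, while \<open>1\<close> has norm \<open>1\<close>.\<close>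

lemma a_tilde_in_SU11: "a_tilde r \<in> SU11"
proof -
  have "a_tilde r = su11_matrix (complex_of_real (cosh r)) (complex_of_real (sinh r))"
    by (simp add: a_tilde_def su11_matrix_def)
  moreover have "(cmod (complex_of_real (cosh r)))\<^sup>2 - (cmod (complex_of_real (sinh r)))\<^sup>2 = 1"
    using cosh_square_eq[of r] by (simp add: norm_of_real)
  ultimately show ?thesis unfolding SU11_def by blast
qed

lemma k_tilde_in_SU11: "k_tilde \<theta> \<in> SU11"
proof -
  have "k_tilde \<theta> = su11_matrix (exp (- (\<i> * complex_of_real \<theta>))) 0"
    by (simp add: k_tilde_def su11_matrix_def exp_cnj)
  moreover have "(cmod (exp (- (\<i> * complex_of_real \<theta>))))\<^sup>2 - (cmod 0)\<^sup>2 = 1"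
    by simp
  ultimately show ?thesis unfolding SU11_def by blast
qed

section \<open>The spaces of holomorphic functions on the unit disk\<close>

text \<open>The index is real here because the case \<open>\<ell> = 1\<close> is a limit over real \<open>s > 1\<close>.\<close>

definition weighted_inner :: "real \<Rightarrow> (complex \<Rightarrow> complex) \<Rightarrow> (complex \<Rightarrow> complex) \<Rightarrow> complex" where
  "weighted_inner s f g = complex_of_real ((s - 1) / pi) *
     (LINT z:ball 0 1|lborel. complex_of_real ((1 - (cmod z)\<^sup>2) powr (s - 2)) * (cnj (f z) * g z))"

definition H_inner :: "nat \<Rightarrow> (complex \<Rightarrow> complex) \<Rightarrow> (complex \<Rightarrow> complex) \<Rightarrow> complex" where
  "H_inner l f g = (if l = 1 then Lim (at_right 1) (\<lambda>s. weighted_inner s f g)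
                    else weighted_inner (real l) f g)"

definition H_norm :: "nat \<Rightarrow> (complex \<Rightarrow> complex) \<Rightarrow> real" where
  "H_norm l f = sqrt (Re (H_inner l f f))"

text \<open>The squared norm with values in \<open>[0, \<infinity>]\<close>. Finiteness of the norm is expressed through it,
  since the integral in \<open>weighted_inner\<close> is by convention 0 if it does not converge.\<close>

definition weighted_norm_sq :: "real \<Rightarrow> (complex \<Rightarrow> complex) \<Rightarrow> ennreal" where
  "weighted_norm_sq s f =
     (\<integral>\<^sup>+ z\<in>ball 0 1. ennreal ((s - 1) / pi * (1 - (cmod z)\<^sup>2) powr (s - 2) * (cmod (f z))\<^sup>2) \<partial>lborel)"

definition H_finite_norm :: "nat \<Rightarrow> (complex \<Rightarrow> complex) \<Rightarrow> bool" where
  "H_finite_norm l f \<longleftrightarrow>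
     (if l = 1 then \<exists>c::real. ((\<lambda>s. weighted_norm_sq s f) \<longlongrightarrow> ennreal c) (at_right 1)
      else weighted_norm_sq (real l) f < \<infinity>)"

text \<open>Elements are represented by total functions; their values off the disk play no role in the
  inner product, the norm or the representations.\<close>

definition H_space :: "nat \<Rightarrow> (complex \<Rightarrow> complex) set" where
  "H_space l = {f. f holomorphic_on ball 0 1 \<and> H_finite_norm l f}"

section \<open>The discrete series representations\<close>

datatype series_sign = Plus | Minus

text \<open>For \<open>x\<close> in \<open>SU11\<close>, \<open>x$1$1\<close> and \<open>x$1$2\<close> are the parameters \<open>\<alpha>\<close> and \<open>\<beta>\<close>.\<close>

fun disk_action :: "series_sign \<Rightarrow> complex^2^2 \<Rightarrow> complex \<Rightarrow> complex" where
  "disk_action Plus x z = (cnj (x$1$1) * z + cnj (x$1$2)) / (x$1$2 * z + x$1$1)"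
| "disk_action Minus x z = (x$1$1 * z + x$1$2) / (cnj (x$1$2) * z + cnj (x$1$1))"

fun multiplier :: "series_sign \<Rightarrow> complex^2^2 \<Rightarrow> complex \<Rightarrow> complex" where
  "multiplier Plus x z = x$1$2 * z + x$1$1"
| "multiplier Minus x z = cnj (x$1$2) * z + cnj (x$1$1)"

definition discrete_series ::
  "series_sign \<Rightarrow> nat \<Rightarrow> complex^2^2 \<Rightarrow> (complex \<Rightarrow> complex) \<Rightarrow> complex \<Rightarrow> complex" where
  "discrete_series \<epsilon> l x f z =
     (let w = disk_action \<epsilon> (matrix_inv x) z in multiplier \<epsilon> x w ^ l * f w)"

end

(*
Taylor coefficients turn H_l into a weighted l^2 space in which z^n has squared norm
h_n = n! (l - 1)! / (n + l - 1)!, and the rotations k_theta act diagonally by characters. Parseval in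
both angles therefore evaluates the double mean of |<f, pi(k a_r k') g>|^2 as
  sum_{n, m} |f_n|^2 h_n^2 |T_{nm}|^2 |g_m|^2,
where T is the matrix of pi(a_r) with respect to the monomials. It remains to show
h_n |T_{nm}|^2 <= h_m / cosh(r)^2. The entries of T are Jacobi polynomials, and cosh(r) T_{nm} is, up
to the normalisation (h_m / h_n)^(1/2), an entry of the unitary matrix by which the rotation with
cosine 1 / cosh(r) acts on binary forms of degree n + m + l - 1; hence it has modulus at most 1.
*)

theory Submission
  imports Defs
begin

section \<open>Matrix coefficients of rotations on binary forms\<close>

text \<open>The binary forms that carry the entry T_{nm} have degree n + m + l - 1, which changes
  with the entry. The rotation therefore controls one entry at a time and does not show that T is
  bounded on the weighted l^2 space. Boundedness is nevertheless needed: the inner product of f with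
  pi(x) g is read off from Taylor coefficients only once those of pi(x) g are known to be square
  summable for the weight h, and the same bound, uniform in the angles, allows the sum over n to be
  integrated term by term. It comes from the noncompact group itself: pi(a_r) and pi(a_{-r}) are
  inverse to each other as substitutions, and the symmetry of the rotation coefficients makes them
  adjoint. To avoid assuming the convergence that is to be proved, the inverse relation is first
  tested on monomials, whose images have poles only outside the closed disk and hence absolutely
  summable coefficients. A further obstacle is l = 1, where the norm is a limit and no single
  integral is available; the index of the weight is therefore a real s > 1 in the area
  integrals.\<close>

lemma coeff_linear_poly_power':
  fixes a b :: "'a :: comm_semiring_1"
  shows "coeff ([:a, b:] ^ n) i = of_nat (n choose i) * b ^ i * a ^ (n - i)"
proof (cases "i \<le> n")
  case False
  have "degree ([:a, b:] ^ n) \<le> degree [:a, b:] * n"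
    by (rule degree_power_le)
  also have "\<dots> \<le> n"
    by simp
  finally show ?thesis
    using False by (simp add: coeff_eq_0 binomial_eq_0)
qed (rule coeff_linear_poly_power)

text \<open>Column \<open>m\<close> of the matrix by which a rotation acts on binary forms of degree \<open>N\<close>. For
  \<open>a\<^sup>2 + b\<^sup>2 = 1\<close> this is a representation of \<open>SU(2)\<close>, unitary when \<open>v\<^sup>n\<close> has squared norm
  \<open>1 / (N choose n)\<close>; \<open>rot_coeff_bound\<close> is the resulting bound of matrix coefficients by 1.\<close>

definition rot_coeff :: "real \<Rightarrow> real \<Rightarrow> nat \<Rightarrow> nat \<Rightarrow> nat \<Rightarrow> real" where
  "rot_coeff a b N n m = coeff ([:- b, a:] ^ m * [:a, b:] ^ (N - m)) n"

lemma rot_coeff_eq: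
  "rot_coeff a b N n m =
     (\<Sum>k\<le>min n m. real (m choose k) * ((N - m) choose (n - k)) *
        (- b) ^ (m - k) * b ^ (n - k) * a ^ (k + (N - m - (n - k))))"
proof -
  have "rot_coeff a b N n m =
     (\<Sum>k\<le>n. real (m choose k) * ((N - m) choose (n - k)) *
        (- b) ^ (m - k) * b ^ (n - k) * a ^ (k + (N - m - (n - k))))"
    unfolding rot_coeff_def coeff_mult coeff_linear_poly_power'
    by (intro sum.cong refl) (simp add: power_add)
  also have "\<dots> = (\<Sum>k\<le>min n m. real (m choose k) * ((N - m) choose (n - k)) *
        (- b) ^ (m - k) * b ^ (n - k) * a ^ (k + (N - m - (n - k))))"
    by (rule sum.mono_neutral_right) auto
  finally show ?thesis .
qed

text \<open>Both sides count ordered pairs of disjoint subsets, of sizes p and q, of a set with M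
  elements.\<close>

lemma choose_mult_swap:
  assumes "p \<le> M" "q \<le> M"
  shows "(M choose p) * ((M - p) choose q) = (M choose q) * ((M - q) choose p)"
proof (cases "p + q \<le> M")
  case True
  have "(M choose (p + q)) * ((p + q) choose p) = (M choose p) * ((M - p) choose q)"
    using choose_mult[of p "p + q" M] True by simp
  moreover have "(M choose (p + q)) * ((p + q) choose q) = (M choose q) * ((M - q) choose p)"
    using choose_mult[of q "p + q" M] True by simp
  moreover have "((p + q) choose q) = ((p + q) choose p)"
    using binomial_symmetric[of q "p + q"] by simp
  ultimately show ?thesis by simp
qed (use assms in \<open>auto simp: binomial_eq_0\<close>)

text \<open>Both sides count pairs (A, B) of subsets of an N-element set with |A| = m, |B| = n and
  |A \<inter> B| = k; one side chooses A first, the other B.\<close>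

lemma choose_mult3_swap:
  assumes "k \<le> m" "k \<le> n" "m \<le> N" "n \<le> N"
  shows "(N choose m) * ((m choose k) * ((N - m) choose (n - k))) =
         (N choose n) * ((n choose k) * ((N - n) choose (m - k)))"
proof -
  have "(N choose m) * (m choose k) = (N choose k) * ((N - k) choose (m - k))"
    using assms by (intro choose_mult) auto
  moreover have "(N choose n) * (n choose k) = (N choose k) * ((N - k) choose (n - k))"
    using assms by (intro choose_mult) auto
  moreover have "((N - k) choose (m - k)) * ((N - m) choose (n - k)) =
      ((N - k) choose (n - k)) * ((N - n) choose (m - k))"
    using choose_mult_swap[of "m - k" "N - k" "n - k"] assms by simp
  ultimately show ?thesis
    by (metis mult.assoc)
qed

text \<open>When the n-th monomial has squared norm 1 / (N choose n), this says that the operators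
  with parameters (a, b) and (a, -b) are adjoint. The two explicit sums agree term by term.\<close>

lemma rot_coeff_symmetric:
  assumes "n \<le> N" "m \<le> N"
  shows "(N choose m) * rot_coeff a b N n m = (N choose n) * rot_coeff a (- b) N m n"
  unfolding rot_coeff_eq sum_distrib_left min.commute[of m n]
proof (intro sum.cong refl)
  fix k assume k: "k \<in> {..min n m}"
  have "real (N choose m) * ((m choose k) * ((N - m) choose (n - k))) =
        real (N choose n) * ((n choose k) * ((N - n) choose (m - k)))"
    using choose_mult3_swap[of k m n N] k assms
    by (metis atMost_iff min.bounded_iff of_nat_mult)
  moreover have "N - m - (n - k) = N - n - (m - k)"
    using k assms by simp
  ultimately show "real (N choose m) * (real (m choose k) * real ((N - m) choose (n - k)) *
        (- b) ^ (m - k) * b ^ (n - k) * a ^ (k + (N - m - (n - k)))) =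
      real (N choose n) * (real (n choose k) * real ((N - n) choose (m - k)) *
        (- (- b)) ^ (n - k) * (- b) ^ (m - k) * a ^ (k + (N - n - (m - k))))"
    by (simp add: mult.assoc[symmetric])
qed

text \<open>The left side is the binary form of degree N belonging to P, evaluated at (x, y). This
  lets a matrix acting on coefficients be read as a fractional linear substitution.\<close>

lemma homogenized_poly:
  fixes x y :: real
  assumes "degree P \<le> N" "y \<noteq> 0"
  shows "(\<Sum>m\<le>N. coeff P m * (x ^ m * y ^ (N - m))) = y ^ N * poly P (x / y)"
proof -
  have "poly P (x / y) = (\<Sum>m\<le>N. coeff P m * (x / y) ^ m)"
    unfolding poly_altdef using assms(1)
    by (intro sum.mono_neutral_left) (auto simp: coeff_eq_0)
  also have "y ^ N * \<dots> = (\<Sum>m\<le>N. coeff P m * (x ^ m * y ^ (N - m)))"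
    unfolding sum_distrib_left
    by (intro sum.cong refl) (use assms(2) in \<open>auto simp: power_divide power_diff field_simps\<close>)
  finally show ?thesis ..
qed

text \<open>Rotating by (a, -b) and then by (a, b) is the identity; \<open>?P\<close> is the image
  under the second rotation of the k-th column of the first.\<close>

lemma rot_coeff_inverse:
  assumes ab: "a\<^sup>2 + b\<^sup>2 = 1" and "k \<le> N"
  shows "(\<Sum>m\<le>N. smult (rot_coeff a (- b) N m k) ([:- b, a:] ^ m * [:a, b:] ^ (N - m))) = monom 1 k"
    (is "?P = ?Q")
proof (rule ccontr)
  define R where "R = [:b, a:] ^ k * [:a, - b:] ^ (N - k)"
  have degR: "degree R \<le> N"
  proof -
    have "degree R \<le> degree ([:b, a:] ^ k) + degree ([:a, - b:] ^ (N - k))"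
      unfolding R_def by (rule degree_mult_le)
    also have "\<dots> \<le> degree [:b, a:] * k + degree [:a, - b:] * (N - k)"
      by (intro add_mono degree_power_le)
    also have "\<dots> \<le> 1 * k + 1 * (N - k)"
      by (intro add_mono mult_right_mono) auto
    finally show ?thesis using \<open>k \<le> N\<close> by simp
  qed
  \<comment> \<open>Dehomogenizing divides by \<open>a + b * t\<close>, so its root is left out. It
    is at most one point, and two polynomials that agree everywhere else are equal.\<close>
  have eq: "poly (?P - ?Q) t = 0" if "a + b * t \<noteq> 0" for t
  proof -
    define x y where "x = a * t - b" and "y = a + b * t"
    have y: "y \<noteq> 0" using that by (simp add: y_def)
    have "poly ?P t = (\<Sum>m\<le>N. coeff R m * (x ^ m * y ^ (N - m)))"
      by (simp add: poly_sum rot_coeff_def R_def x_def y_def algebra_simps)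
    also have "\<dots> = y ^ N * poly R (x / y)"
      by (rule homogenized_poly[OF degR y])
    also have "\<dots> = (y ^ k * poly [:b, a:] (x / y) ^ k) * (y ^ (N - k) * poly [:a, -b:] (x / y) ^ (N - k))"
      using \<open>k \<le> N\<close> by (simp add: R_def flip: power_add)
    also have "\<dots> = (y * poly [:b, a:] (x / y)) ^ k * (y * poly [:a, -b:] (x / y)) ^ (N - k)"
      by (simp only: power_mult_distrib)
    also have "y * poly [:b, a:] (x / y) = (a\<^sup>2 + b\<^sup>2) * t"
      using y by (simp add: field_simps) (simp add: x_def y_def power2_eq_square algebra_simps)
    also have "y * poly [:a, -b:] (x / y) = a\<^sup>2 + b\<^sup>2"
      using y by (simp add: field_simps) (simp add: x_def y_def power2_eq_square algebra_simps)
    finally show ?thesis using ab by (simp add: poly_monom)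
  qed
  assume "?P \<noteq> ?Q"
  hence "finite {t. poly (?P - ?Q) t = 0}"
    by (intro poly_roots_finite) simp
  moreover have "{t. poly [:a, b:] t \<noteq> 0} \<subseteq> {t. poly (?P - ?Q) t = 0}"
    using eq by (auto simp: mult.commute)
  ultimately have "finite {t. poly [:a, b:] t \<noteq> 0}"
    by (rule rev_finite_subset)
  moreover have "finite {t. poly [:a, b:] t = 0}"
    using ab by (intro poly_roots_finite) auto
  ultimately have "finite ({t. poly [:a, b:] t \<noteq> 0} \<union> {t. poly [:a, b:] t = 0})"
    by (rule finite_UnI)
  also have "{t. poly [:a, b:] t \<noteq> 0} \<union> {t. poly [:a, b:] t = 0} = (UNIV :: real set)"
    by auto
  finally show False
    using infinite_UNIV_char_0 by blast
qed

lemma rot_coeff_bound: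
  assumes ab: "a\<^sup>2 + b\<^sup>2 = 1" and n: "n \<le> N" and m: "m \<le> N"
  shows "(rot_coeff a b N n m)\<^sup>2 * (N choose m) \<le> (N choose n)"
proof -
  \<comment> \<open>This is the diagonal entry (n, n) of the product of a rotation with its inverse.
    The adjoint relation turns it into a weighted sum of squares along row n, of which the wanted
    bound keeps one term.\<close>
  have "(\<Sum>m\<le>N. rot_coeff a (- b) N m n * rot_coeff a b N n m) = 1"
    using arg_cong[OF rot_coeff_inverse[OF ab n], of "\<lambda>P. coeff P n"]
    by (simp add: coeff_sum flip: rot_coeff_def)
  hence "(N choose n) = (\<Sum>m\<le>N. ((N choose n) * rot_coeff a (- b) N m n) * rot_coeff a b N n m)"
    by (simp add: mult.assoc flip: sum_distrib_left)
  also have "\<dots> = (\<Sum>m\<le>N. (rot_coeff a b N n m)\<^sup>2 * (N choose m))"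
    by (intro sum.cong refl, subst rot_coeff_symmetric[symmetric])
       (use n in \<open>auto simp: power2_eq_square\<close>)
  also have "\<dots> \<ge> (\<Sum>m\<in>{m}. (rot_coeff a b N n m)\<^sup>2 * (N choose m))"
    using m by (intro sum_mono2) auto
  finally show ?thesis by simp
qed

text \<open>The coefficient of \<open>u\<^sup>n\<close> in the image \<open>(c u - s)\<^sup>m / (c - s u)\<close>\<open>\<^bsup>l + m\<^esup>\<close> of \<open>u\<^sup>m\<close> under the
  representation of \<open>a_tilde r\<close>, where \<open>c = cosh r\<close>, \<open>s = sinh r\<close> and \<open>l = p + 1\<close>.\<close>

definition ds_coeff :: "nat \<Rightarrow> real \<Rightarrow> nat \<Rightarrow> nat \<Rightarrow> real" where
  "ds_coeff p r n m =
     (\<Sum>k\<le>min n m. real (m choose k) * ((n + p) choose (n - k)) *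
        (- sinh r) ^ (m - k) * sinh r ^ (n - k)) / cosh r ^ (p + 1 + n + m)"

text \<open>Substituting \<open>u = c v / (1 + s v)\<close> in the contour integral for the coefficient turns it into a
  coefficient of the compact group, up to a factor \<open>1 / cosh r\<close>. This is the source of the decay.\<close>

lemma ds_coeff_eq_rot_coeff:
  "ds_coeff p r n m = rot_coeff (1 / cosh r) (tanh r) (n + m + p) n m / cosh r"
proof -
  have "rot_coeff (1 / cosh r) (tanh r) (n + m + p) n m =
      (\<Sum>k\<le>min n m. real (m choose k) * ((n + p) choose (n - k)) *
        (- sinh r) ^ (m - k) * sinh r ^ (n - k) / cosh r ^ (p + n + m))"
    unfolding rot_coeff_eq
  proof (intro sum.cong refl)
    fix k assume "k \<in> {..min n m}"
    hence k: "k \<le> n" "k \<le> m" by auto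
    have "cosh r ^ (p + n + m) = cosh r ^ (m - k) * cosh r ^ (n - k) * cosh r ^ (k + (n + p - (n - k)))"
    proof -
      have "p + n + m = (m - k) + (n - k) + (k + (n + p - (n - k)))"
        using k by simp
      thus ?thesis by (simp only: power_add)
    qed
    thus "real (m choose k) * real ((n + m + p - m) choose (n - k)) * (- tanh r) ^ (m - k) *
        tanh r ^ (n - k) * (1 / cosh r) ^ (k + (n + m + p - m - (n - k))) =
        real (m choose k) * ((n + p) choose (n - k)) *
        (- sinh r) ^ (m - k) * sinh r ^ (n - k) / cosh r ^ (p + n + m)"
      by (simp add: tanh_def power_divide minus_divide_left del: minus_divide_left[symmetric])
  qed
  thus ?thesis
    by (simp add: ds_coeff_def sum_divide_distrib[symmetric])
qed

text \<open>The squared norm of \<open>z \<mapsto> z\<^sup>n\<close> in \<open>H_space (p + 1)\<close>.\<close>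

definition monom_norm_sq :: "nat \<Rightarrow> nat \<Rightarrow> real" where
  "monom_norm_sq p n = 1 / real ((n + p) choose p)"

lemma monom_norm_sq_pos [simp]: "monom_norm_sq p n > 0"
  by (simp add: monom_norm_sq_def)

lemma monom_norm_sq_nonneg [simp]: "monom_norm_sq p n \<ge> 0"
  by (simp add: monom_norm_sq_def)

lemma monom_norm_sq_nonzero [simp]: "monom_norm_sq p n \<noteq> 0"
  using monom_norm_sq_pos[of p n] by linarith

lemma monom_norm_sq_le_1: "monom_norm_sq p n \<le> 1"
proof -
  have "real ((n + p) choose p) \<ge> 1"
    using zero_less_binomial[of p "n + p"] by linarith
  thus ?thesis by (simp add: monom_norm_sq_def)
qed

text \<open>Both sides are the trinomial coefficient (n + m + p)! / (n! m! p!). It follows that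
  \<open>z^n\<close> and \<open>z^m\<close> have the same ratio of squared norms among binary forms
  of degree n + m + p as in \<open>H_space (p + 1)\<close>.\<close>

lemma choose_ratio:
  "real ((n + m + p) choose n) * real ((m + p) choose p) = real ((n + m + p) choose m) * real ((n + p) choose p)"
proof -
  have "((n + m + p) choose n) * ((m + p) choose p) = ((n + m + p) choose p) * ((n + m) choose n)"
    using choose_mult_swap[of n "n + m + p" p] by (simp add: add.assoc)
  moreover have "((n + m + p) choose m) * ((n + p) choose p) = ((n + m + p) choose p) * ((n + m) choose m)"
    using choose_mult_swap[of m "n + m + p" p] by simp
  moreover have "((n + m) choose n) = ((n + m) choose m)"
    using binomial_symmetric[of n "n + m"] by simp
  ultimately show ?thesis by (metis of_nat_mult)
qed

lemma ds_coeff_bound: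
  "monom_norm_sq p n * (ds_coeff p r n m)\<^sup>2 \<le> monom_norm_sq p m / (cosh r)\<^sup>2"
proof -
  define N R where "N = n + m + p" and "R = rot_coeff (1 / cosh r) (tanh r) N n m"
  have "(1 / cosh r)\<^sup>2 + (tanh r)\<^sup>2 = 1"
    using cosh_square_eq[of r] cosh_real_pos[of r]
    using add_nonneg_eq_0_iff[of "(sinh r)\<^sup>2" 1]
    by (simp add: tanh_def power_divide flip: add_divide_distrib)
  hence "R\<^sup>2 * real (N choose m) \<le> real (N choose n)"
    unfolding R_def by (rule rot_coeff_bound) (auto simp: N_def)
  hence "R\<^sup>2 * real (N choose m) * real ((m + p) choose p) \<le> real (N choose n) * real ((m + p) choose p)"
    by (intro mult_right_mono) auto
  also have "\<dots> = real (N choose m) * real ((n + p) choose p)"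
    using choose_ratio[of n m p] by (simp add: N_def)
  finally have "real (N choose m) * (R\<^sup>2 * real ((m + p) choose p)) \<le> real (N choose m) * real ((n + p) choose p)"
    by (simp add: mult_ac)
  hence "R\<^sup>2 * real ((m + p) choose p) \<le> real ((n + p) choose p)"
    by (rule mult_left_le_imp_le) (simp add: N_def)
  hence "R\<^sup>2 / real ((n + p) choose p) \<le> 1 / real ((m + p) choose p)"
    by (simp add: field_simps)
  hence "R\<^sup>2 / real ((n + p) choose p) / (cosh r)\<^sup>2 \<le> 1 / real ((m + p) choose p) / (cosh r)\<^sup>2"
    by (rule divide_right_mono) simp
  thus ?thesis
    by (simp add: ds_coeff_eq_rot_coeff R_def N_def power_divide mult.commute monom_norm_sq_def)
qed

text \<open>The matrices for r and -r are adjoint for the weight \<open>monom_norm_sq p\<close>.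
  This is inherited from the rotations, since changing the sign of r changes only the sign of
  \<open>tanh r\<close>.\<close>

lemma ds_coeff_symmetric:
  "monom_norm_sq p n * ds_coeff p r n m = monom_norm_sq p m * ds_coeff p (- r) m n"
proof -
  have *: "real ((n + m + p) choose n) > 0" "real ((n + m + p) choose m) > 0"
    by simp_all
  have "real ((n + m + p) choose m) * ds_coeff p r n m = ((n + m + p) choose n) * ds_coeff p (- r) m n"
    using rot_coeff_symmetric[of n "n + m + p" m "1 / cosh r" "tanh r"]
    by (simp add: ds_coeff_eq_rot_coeff add.commute)
  moreover have "real ((n + m + p) choose n) / real ((n + p) choose p) = real ((n + m + p) choose m) / real ((m + p) choose p)"
    using choose_ratio[of n m p] by (simp add: field_simps)
  ultimately have "real ((n + m + p) choose m) * (ds_coeff p r n m / real ((n + p) choose p)) =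
       real ((n + m + p) choose m) * (ds_coeff p (- r) m n / real ((m + p) choose p))"
    by (metis (no_types) mult.commute times_divide_eq_left times_divide_eq_right)
  hence "ds_coeff p r n m / real ((n + p) choose p) = ds_coeff p (- r) m n / real ((m + p) choose p)"
    using *(2) unfolding mult_cancel_left by linarith
  thus ?thesis by (simp add: monom_norm_sq_def)
qed

section \<open>The action of the hyperbolic elements on power series\<close>

text \<open>Fubini for double series under iterated absolute convergence. The exchange itself takes
  place among unordered sums \<open>infsum\<close>, where absolute summability is symmetric in the
  two indices.\<close>

lemma suminf_swap_abs:
  fixes x :: "nat \<Rightarrow> nat \<Rightarrow> 'a :: banach"
  assumes inner: "\<And>n. summable (\<lambda>m. norm (x n m))"
    and outer: "summable (\<lambda>n. \<Sum>m. norm (x n m))"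
  shows "(\<lambda>n. \<Sum>m. x n m) sums (\<Sum>m. \<Sum>n. x n m)"
    and "\<And>m. summable (\<lambda>n. norm (x n m))"
proof -
  \<comment> \<open>The bridge between ordered and unordered sums. It is stated for an arbitrary
    type because it is applied both to the terms and to their norms.\<close>
  have inf: "(\<Sum>\<^sub>\<infinity>m. y m) = (\<Sum>m. y m)" if "summable (\<lambda>m. norm (y m))" for y :: "nat \<Rightarrow> 'b :: banach"
    using norm_summable_imp_has_sum[OF that summable_sums[OF summable_norm_cancel[OF that]]]
    by (rule infsumI)
  have outer': "summable (\<lambda>n. norm (\<Sum>m. norm (x n m)))"
    using outer inner by (simp add: suminf_nonneg)
  have abs: "(\<lambda>z. norm (case z of (n, m) \<Rightarrow> x n m)) summable_on UNIV \<times> UNIV"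
  proof (intro Infinite_Sum.abs_summable_on_Sigma_iff[THEN iffD2] conjI ballI)
    show "(\<lambda>m. norm (case (n, m) of (n, m) \<Rightarrow> x n m)) summable_on UNIV" for n
      using inner[of n] norm_summable_imp_summable_on[of "\<lambda>m. norm (x n m)"] by simp
    show "(\<lambda>n. norm (\<Sum>\<^sub>\<infinity>m. norm (case (n, m) of (n, m) \<Rightarrow> x n m))) summable_on UNIV"
      using norm_summable_imp_summable_on[of "\<lambda>n. norm (\<Sum>m. norm (x n m))"] outer' inner
      by (simp add: inf)
  qed
  have abs': "(\<lambda>z. norm (case z of (m, n) \<Rightarrow> x n m)) summable_on UNIV \<times> UNIV"
    using abs by (subst summable_on_swap) (simp add: case_prod_unfold)
  note abs' = abs'[unfolded Infinite_Sum.abs_summable_on_Sigma_iff]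
  show *: "summable (\<lambda>n. norm (x n m))" for m
    using abs' summable_on_imp_summable[of "\<lambda>n. norm (x n m)"] by simp
  have sum: "(\<lambda>(n, m). x n m) summable_on UNIV \<times> UNIV"
    using abs by (rule abs_summable_summable)
  have "summable (\<lambda>n. norm (\<Sum>m. x n m))"
    by (rule summable_comparison_test'[OF outer, of 0]) (simp add: summable_norm inner)
  hence "(\<lambda>n. \<Sum>m. x n m) sums (\<Sum>\<^sub>\<infinity>n. \<Sum>m. x n m)"
    by (simp add: inf summable_norm_cancel summable_sums)
  also have "(\<Sum>\<^sub>\<infinity>n. \<Sum>m. x n m) = (\<Sum>\<^sub>\<infinity>n. \<Sum>\<^sub>\<infinity>m. x n m)"
    by (simp add: inf inner)
  also have "\<dots> = (\<Sum>\<^sub>\<infinity>m. \<Sum>\<^sub>\<infinity>n. x n m)"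
    by (rule infsum_swap_banach) (use sum in simp)
  also have "\<dots> = (\<Sum>\<^sub>\<infinity>m. \<Sum>n. x n m)"
    by (simp add: inf *)
  also have "\<dots> = (\<Sum>m. \<Sum>n. x n m)"
  proof (rule inf)
    have "(\<lambda>m. norm (\<Sum>\<^sub>\<infinity>n. norm (x n m))) summable_on UNIV"
      using abs' by simp
    hence "summable (\<lambda>m. norm (\<Sum>n. norm (x n m)))"
      using summable_on_imp_summable by (simp add: inf *)
    thus "summable (\<lambda>m. norm (\<Sum>n. x n m))"
      by (rule summable_comparison_test'[where N = 0])
         (use * in \<open>auto simp: suminf_nonneg intro!: summable_norm\<close>)
  qed
  finally show "(\<lambda>n. \<Sum>m. x n m) sums (\<Sum>m. \<Sum>n. x n m)" .
qed

text \<open>Newton's series for the exponent -(p + 1). Its coefficients are the reciprocals of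
  \<open>monom_norm_sq p n\<close>, so a coefficient bound of the form
  \<open>C / monom_norm_sq p n\<close> gives convergence in the whole disk.\<close>

lemma negative_binomial_sums:
  fixes z :: complex
  assumes "norm z < 1"
  shows "(\<lambda>n. of_nat ((n + p) choose p) * z ^ n) sums (1 / (1 - z) ^ Suc p)"
proof -
  have nz: "1 - z \<noteq> 0" using assms by auto
  have "(\<lambda>n. (- of_nat (Suc p) gchoose n) * (- z) ^ n) sums (1 + - z) powr (- of_nat (Suc p))"
    by (rule gen_binomial_complex) (use assms in simp)
  also have "(\<lambda>n. (- of_nat (Suc p) gchoose n) * (- z) ^ n) = (\<lambda>n. of_nat ((n + p) choose p) * z ^ n)"
  proof
    fix n
    have "(- of_nat (Suc p) gchoose n :: complex) = (- 1) ^ n * ((of_nat (n + p)) gchoose n)"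
      unfolding gbinomial_minus by (simp add: add_ac)
    also have "(of_nat (n + p) gchoose n :: complex) = of_nat ((n + p) choose n)"
      by (simp only: binomial_gbinomial)
    also have "(n + p) choose n = (n + p) choose p"
      using binomial_symmetric[of n "n + p"] by simp
    finally have "(- of_nat (Suc p) gchoose n) * (- z) ^ n =
        of_nat ((n + p) choose p) * ((- 1) ^ n * (- z) ^ n)"
      by (simp only: mult_ac)
    also have "(- 1) ^ n * (- z) ^ n = z ^ n"
      by (simp flip: power_mult_distrib)
    finally show "(- of_nat (Suc p) gchoose n) * (- z) ^ n = of_nat ((n + p) choose p) * z ^ n" .
  qed
  also have "(1 + - z) powr (- of_nat (Suc p)) = 1 / (1 - z) ^ Suc p"
    unfolding powr_minus using nz by (subst powr_nat') (auto simp: field_simps)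
  finally show ?thesis .
qed

lemma summable_binomial_powser:
  fixes x :: real
  assumes "0 \<le> x" "x < 1"
  shows "summable (\<lambda>n. real ((n + p) choose p) * x ^ n)"
proof -
  have "summable (\<lambda>n. complex_of_real (real ((n + p) choose p) * x ^ n))"
    using sums_summable[OF negative_binomial_sums[of "of_real x" p]] assms by simp
  thus ?thesis by (simp only: summable_complex_of_real)
qed

lemma cosh_minus_nonzero:
  assumes "norm (sinh r *\<^sub>R u) < cosh r"
  shows "of_real (cosh r) - of_real (sinh r) * (u :: complex) \<noteq> 0"
proof
  assume "of_real (cosh r) - of_real (sinh r) * u = 0"
  hence "norm (of_real (cosh r) :: complex) = norm (of_real (sinh r) * u)" by simp
  thus False using assms by (simp add: norm_mult)
qed

text \<open>Generating function of column m, which is the image of \<open>u^m\<close>. The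
  hypothesis describes a disk of radius greater than 1 (the whole plane if r = 0);
  \<open>summable_ds_coeff_column\<close> relies on this surplus.\<close>

lemma ds_coeff_sums:
  fixes u :: complex
  assumes u: "norm (sinh r *\<^sub>R u) < cosh r"
  shows "(\<lambda>n. of_real (ds_coeff p r n m) * u ^ n) sums
           ((of_real (cosh r) * u - of_real (sinh r)) ^ m /
            (of_real (cosh r) - of_real (sinh r) * u) ^ (Suc p + m))"
proof -
  define c s :: complex where "c = of_real (cosh r)" and "s = of_real (sinh r)"
  have c: "c \<noteq> 0" and cs: "c\<^sup>2 - s\<^sup>2 = 1"
    using cosh_square_eq[of r]
    by (simp_all add: c_def s_def flip: of_real_power of_real_diff)
  define D where "D = c - s * u"
  have D: "D \<noteq> 0" using cosh_minus_nonzero[OF u] by (simp add: D_def c_def s_def)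
  \<comment> \<open>Negative binomial series in \<open>s * u / c\<close>, multiplied by
    \<open>u^k\<close>. The shift of the index by k adds no terms, because
    \<open>(n + p) choose (p + k)\<close> is 0 for n < k.\<close>
  have basic: "(\<lambda>n. of_nat ((n + p) choose (p + k)) * s ^ (n - k) / c ^ (p + 1 + n) * u ^ n) sums
        (u ^ k / D ^ (p + 1 + k))" for k
  proof -
    have "norm (s * u / c) < 1"
      using u by (simp add: s_def c_def norm_mult norm_divide)
    from sums_mult2[OF negative_binomial_sums[OF this, of "p + k"], of "u ^ k / c ^ (p + 1 + k)"]
    have "(\<lambda>n. of_nat ((n + (p + k)) choose (p + k)) * (s * u / c) ^ n * (u ^ k / c ^ (p + 1 + k))) sums
          (1 / (1 - s * u / c) ^ Suc (p + k) * (u ^ k / c ^ (p + 1 + k)))" .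
    also have "1 - s * u / c = D / c"
      using c by (simp add: D_def field_simps)
    also have "1 / (D / c) ^ Suc (p + k) * (u ^ k / c ^ (p + 1 + k)) = u ^ k / D ^ (p + 1 + k)"
      using c D by (simp add: power_divide)
    also have "(\<lambda>n. of_nat ((n + (p + k)) choose (p + k)) * (s * u / c) ^ n * (u ^ k / c ^ (p + 1 + k))) =
       (\<lambda>n. of_nat (((n + k) + p) choose (p + k)) * s ^ ((n + k) - k) / c ^ (p + 1 + (n + k)) * u ^ (n + k))"
      by (simp add: power_divide power_mult_distrib power_add add_ac mult_ac)
    finally show ?thesis
      by (subst (asm) sums_zero_iff_shift) (auto simp: binomial_eq_0)
  qed
  \<comment> \<open>Since \<open>c^2 - s^2 = 1\<close>, the numerator satisfies c (c u - s) = u - s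
    D. Expanding the m-th power of the right side in u and D leaves only quotients of the form
    treated in \<open>basic\<close>.\<close>
  have "(\<lambda>n. \<Sum>k\<le>m. of_nat (m choose k) * (- s) ^ (m - k) / c ^ m *
         (of_nat ((n + p) choose (p + k)) * s ^ (n - k) / c ^ (p + 1 + n) * u ^ n)) sums
        (\<Sum>k\<le>m. of_nat (m choose k) * (- s) ^ (m - k) / c ^ m * (u ^ k / D ^ (p + 1 + k)))"
    by (intro sums_sum sums_mult basic)
  also have "(\<Sum>k\<le>m. of_nat (m choose k) * (- s) ^ (m - k) / c ^ m * (u ^ k / D ^ (p + 1 + k))) =
      (\<Sum>k\<le>m. of_nat (m choose k) * u ^ k * (- s * D) ^ (m - k)) / (c ^ m * D ^ (Suc p + m))"
    unfolding sum_divide_distrib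
  proof (intro sum.cong refl)
    fix k assume "k \<in> {..m}"
    hence "D ^ (Suc p + m) = D ^ (p + 1 + k) * D ^ (m - k)" by (simp flip: power_add)
    thus "of_nat (m choose k) * (- s) ^ (m - k) / c ^ m * (u ^ k / D ^ (p + 1 + k)) =
        of_nat (m choose k) * u ^ k * (- s * D) ^ (m - k) / (c ^ m * D ^ (Suc p + m))"
      unfolding power_mult_distrib[of "- s" D] using D c by simp
  qed
  also have "(\<Sum>k\<le>m. of_nat (m choose k) * u ^ k * (- s * D) ^ (m - k)) = (u + - s * D) ^ m"
    by (subst binomial_ring) simp
  also have "u + - s * D = (c\<^sup>2 - s\<^sup>2) * u + - s * D" by (simp add: cs)
  also have "\<dots> = c * (c * u - s)" by (simp add: D_def power2_eq_square algebra_simps)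
  also have "(c * (c * u - s)) ^ m / (c ^ m * D ^ (Suc p + m)) = (c * u - s) ^ m / D ^ (Suc p + m)"
    using c by (simp add: power_mult_distrib)
  also have "(\<lambda>n. \<Sum>k\<le>m. of_nat (m choose k) * (- s) ^ (m - k) / c ^ m *
         (of_nat ((n + p) choose (p + k)) * s ^ (n - k) / c ^ (p + 1 + n) * u ^ n)) =
      (\<lambda>n. of_real (ds_coeff p r n m) * u ^ n)"
  proof
    fix n
    have "of_real (ds_coeff p r n m) =
      (\<Sum>k\<le>min n m. of_nat (m choose k) * of_nat ((n + p) choose (n - k)) *
        (- s) ^ (m - k) * s ^ (n - k)) / c ^ (p + 1 + n + m)"
      by (simp add: ds_coeff_def s_def c_def)
    also have "(\<Sum>k\<le>min n m. of_nat (m choose k) * of_nat ((n + p) choose (n - k)) *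
        (- s) ^ (m - k) * s ^ (n - k)) =
      (\<Sum>k\<le>min n m. of_nat (m choose k) * of_nat ((n + p) choose (p + k)) *
        (- s) ^ (m - k) * s ^ (n - k))"
    proof (intro sum.cong refl)
      fix k assume "k \<in> {..min n m}"
      hence "(n + p) choose (n - k) = (n + p) choose (p + k)"
        using binomial_symmetric[of "n - k" "n + p"] by (simp add: add.commute)
      thus "of_nat (m choose k) * of_nat ((n + p) choose (n - k)) * (- s) ^ (m - k) * s ^ (n - k) =
        of_nat (m choose k) * of_nat ((n + p) choose (p + k)) * (- s) ^ (m - k) * s ^ (n - k)"
        by simp
    qed
    also have "\<dots> = (\<Sum>k\<le>m. of_nat (m choose k) * of_nat ((n + p) choose (p + k)) *
        (- s) ^ (m - k) * s ^ (n - k))"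
      by (rule sum.mono_neutral_left) (auto simp: binomial_eq_0)
    finally have "of_real (ds_coeff p r n m) = \<dots> / c ^ (p + 1 + n + m)" .
    thus "(\<Sum>k\<le>m. of_nat (m choose k) * (- s) ^ (m - k) / c ^ m *
         (of_nat ((n + p) choose (p + k)) * s ^ (n - k) / c ^ (p + 1 + n) * u ^ n)) =
        of_real (ds_coeff p r n m) * u ^ n"
      by (simp add: sum_divide_distrib sum_distrib_left sum_distrib_right power_add mult_ac)
  qed
  finally show ?thesis by (simp add: c_def s_def D_def)
qed

text \<open>A majorant independent of m. Replacing the square root of 1 /
  \<open>monom_norm_sq p n\<close> by the number itself, which is at least 1, matches the
  coefficients of the negative binomial series.\<close>

lemma abs_ds_coeff_le: "\<bar>ds_coeff p r n m\<bar> \<le> 1 / monom_norm_sq p n"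
proof -
  have "monom_norm_sq p n * (ds_coeff p r n m)\<^sup>2 \<le> monom_norm_sq p m / (cosh r)\<^sup>2"
    by (rule ds_coeff_bound)
  also have "\<dots> \<le> 1 / 1"
    by (intro frac_le monom_norm_sq_le_1) (auto simp: cosh_real_ge_1)
  finally have "(ds_coeff p r n m)\<^sup>2 \<le> 1 / monom_norm_sq p n"
    by (simp add: field_simps)
  also have "\<dots> \<le> (1 / monom_norm_sq p n)\<^sup>2"
    using monom_norm_sq_le_1[of p n] by (simp add: power2_eq_square divide_simps)
  finally have "\<bar>ds_coeff p r n m\<bar> \<le> \<bar>1 / monom_norm_sq p n\<bar>"
    by (simp only: abs_le_square_iff)
  thus ?thesis by simp
qed

lemma boost_in_disk:
  fixes u :: complex
  assumes "norm u < 1"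
  shows "norm ((of_real (cosh r) * u - of_real (sinh r)) / (of_real (cosh r) - of_real (sinh r) * u)) < 1"
    and "norm (sinh r *\<^sub>R u) < cosh r"
proof -
  have "\<bar>sinh r\<bar> < cosh r"
    by (metis abs_of_nonneg cosh_real_nonneg cosh_square_eq less_add_one power2_less_imp_less abs_ge_zero power2_abs)
  hence "\<bar>sinh r\<bar> * norm u < cosh r"
    using assms by (smt (verit) mult_left_le abs_ge_zero norm_ge_zero)
  thus *: "norm (sinh r *\<^sub>R u) < cosh r" by simp
  have nz: "of_real (cosh r) - of_real (sinh r) * u \<noteq> 0"
    by (rule cosh_minus_nonzero[OF *])
  have "(norm (of_real (cosh r) - of_real (sinh r) * u))\<^sup>2 - (norm (of_real (cosh r) * u - of_real (sinh r)))\<^sup>2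
     = ((cosh r)\<^sup>2 - (sinh r)\<^sup>2) * (1 - (norm u)\<^sup>2)"
    unfolding cmod_power2 by (simp add: power2_eq_square algebra_simps)
  also have "(cosh r)\<^sup>2 - (sinh r)\<^sup>2 = 1"
    using cosh_square_eq[of r] by simp
  also have "1 * (1 - (norm u)\<^sup>2) > 0"
    using assms abs_square_less_1[of "norm u"] by simp
  finally have "(norm (of_real (cosh r) * u - of_real (sinh r)))\<^sup>2 < (norm (of_real (cosh r) - of_real (sinh r) * u))\<^sup>2"
    by (simp only: diff_gt_0_iff_gt)
  hence "norm (of_real (cosh r) * u - of_real (sinh r)) < norm (of_real (cosh r) - of_real (sinh r) * u)"
    by (rule power2_less_imp_less) (rule norm_ge_zero)
  thus "norm ((of_real (cosh r) * u - of_real (sinh r)) / (of_real (cosh r) - of_real (sinh r) * u)) < 1"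
    using nz by (simp add: norm_divide)
qed

text \<open>Multiplying the coefficient sequence by the matrix realizes the substitution with its
  automorphy factor, after an exchange of the sums over n and m. The bounds that justify the
  exchange are hypotheses because they are verified twice: for absolutely summable g through the
  entrywise bound, and for square summable g through the row norms, whose computation depends on the
  first case.\<close>

lemma ds_coeff_transform_sums:
  fixes g :: "nat \<Rightarrow> complex"
  assumes G: "\<And>w. norm w < 1 \<Longrightarrow> (\<lambda>m. g m * w ^ m) sums G w"
    and summ: "\<And>n. summable (\<lambda>m. \<bar>ds_coeff p r n m\<bar> * norm (g m))"
    and bnd: "\<And>n. (\<Sum>m. \<bar>ds_coeff p r n m\<bar> * norm (g m)) \<le> C / monom_norm_sq p n"
    and u: "norm u < 1"
  shows "(\<lambda>n. (\<Sum>m. of_real (ds_coeff p r n m) * g m) * u ^ n) sums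
     (G ((of_real (cosh r) * u - of_real (sinh r)) / (of_real (cosh r) - of_real (sinh r) * u)) /
       (of_real (cosh r) - of_real (sinh r) * u) ^ Suc p)"
proof -
  define D where "D = of_real (cosh r) - of_real (sinh r) * u"
  define w where "w = (of_real (cosh r) * u - of_real (sinh r)) / D"
  have D: "D \<noteq> 0" unfolding D_def by (rule cosh_minus_nonzero[OF boost_in_disk(2)[OF u]])
  have w: "norm w < 1" unfolding w_def D_def by (rule boost_in_disk(1)[OF u])
  define x where "x = (\<lambda>n m. of_real (ds_coeff p r n m) * g m * u ^ n)"
  have x: "norm (x n m) = \<bar>ds_coeff p r n m\<bar> * norm (g m) * norm u ^ n" for n m
    by (simp add: x_def norm_mult norm_power)
  have 1: "summable (\<lambda>m. norm (x n m))" for n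
    unfolding x by (intro summable_mult2 summ)
  have 2: "summable (\<lambda>n. \<Sum>m. norm (x n m))"
  proof (rule summable_comparison_test'[where N = 0])
    show "summable (\<lambda>n. C * (real ((n + p) choose p) * norm u ^ n))"
      using u by (intro summable_mult summable_binomial_powser) auto
    fix n
    have "norm (\<Sum>m. norm (x n m)) = (\<Sum>m. norm (x n m))"
      using 1 by (simp add: suminf_nonneg)
    also have "\<dots> = (\<Sum>m. \<bar>ds_coeff p r n m\<bar> * norm (g m)) * norm u ^ n"
      unfolding x by (intro suminf_mult2[symmetric] summ)
    also have "\<dots> \<le> C / monom_norm_sq p n * norm u ^ n"
      by (intro mult_right_mono bnd) auto
    finally show "norm (\<Sum>m. norm (x n m)) \<le> C * (real ((n + p) choose p) * norm u ^ n)"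
      by (simp add: monom_norm_sq_def)
  qed
  have "(\<Sum>m. x n m) = (\<Sum>m. of_real (ds_coeff p r n m) * g m) * u ^ n" for n
    unfolding x_def
    by (rule suminf_mult2[symmetric], rule summable_norm_cancel) (simp add: norm_mult summ)
  moreover have "(\<Sum>n. x n m) = g m * w ^ m / D ^ Suc p" for m
  proof -
    have "(\<lambda>n. x n m) sums (g m * ((of_real (cosh r) * u - of_real (sinh r)) ^ m / D ^ (Suc p + m)))"
      using sums_mult[OF ds_coeff_sums[OF boost_in_disk(2)[OF u, of r], of p m], of "g m"]
      by (simp only: x_def D_def mult_ac)
    thus ?thesis by (simp add: sums_iff w_def power_divide power_add mult_ac)
  qed
  moreover have "(\<Sum>m. g m * w ^ m / D ^ Suc p) = G w / D ^ Suc p"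
    using sums_divide[OF G[OF w]] by (simp add: sums_iff)
  ultimately show ?thesis
    using suminf_swap_abs(1)[OF 1 2] by (simp add: w_def D_def)
qed

section \<open>Unitarity of the matrix \<open>ds_coeff\<close>\<close>

lemma powser_coeffs_zero:
  fixes d :: "nat \<Rightarrow> complex"
  assumes "\<And>u. norm u < 1 \<Longrightarrow> (\<lambda>n. d n * u ^ n) sums 0"
  shows "d n = 0"
\<comment> \<open>Isolation of zeros, in the form \<open>powser_0_nonzero\<close>, asks for a
  nonzero coefficient of positive index. The constant term is therefore read off at 0.\<close>
proof (cases "n = 0")
  case True
  have "(\<lambda>n. d n * 0 ^ n) sums 0" by (rule assms) simp
  thus ?thesis using True by simp
next
  case False
  show ?thesis
  proof (rule ccontr)
    assume n: "d n \<noteq> 0"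
    show False
    proof (rule powser_0_nonzero[of 1 0 d "\<lambda>_. 0" n])
      show "(\<lambda>i. d i * (x - 0) ^ i) sums 0" if "norm (x - 0) < 1" for x
        using assms[of x] that by simp
      fix s :: real
      assume s: "0 < s" "\<And>z :: complex. z \<in> cball 0 s - {0} \<Longrightarrow> (0 :: complex) \<noteq> 0"
      from s(2)[of "of_real s"] s(1) show False by simp
    qed (use n False in auto)
  qed
qed

lemma summable_ds_coeff_column: "summable (\<lambda>n. \<bar>ds_coeff p r n m\<bar>)"
proof -
  define t where "t = \<bar>tanh r\<bar>"
  have t: "0 \<le> t" "t < 1" using tanh_real_lt_1[of r] tanh_real_gt_neg1[of r] by (auto simp: t_def abs_if)
  \<comment> \<open>The harmonic mean of 1 and 1 / t: a point beyond 1 that still lies inside the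
    disk of convergence. Convergence there gives absolute convergence at 1.\<close>
  define x where "x = 2 / (1 + t)"
  have x: "x > 1" "t * x < 1" using t by (auto simp: x_def field_simps)
  have "norm (sinh r *\<^sub>R (of_real x :: complex)) = t * x * cosh r"
    using x by (simp add: t_def tanh_def)
  also have "\<dots> < 1 * cosh r" using x by (intro mult_strict_right_mono) auto
  finally have "norm (sinh r *\<^sub>R (of_real x :: complex)) < cosh r" by simp
  from sums_summable[OF ds_coeff_sums[OF this, of p m]]
  have "summable (\<lambda>n. norm (of_real (ds_coeff p r n m) * (1 :: complex) ^ n))"
    by (rule powser_insidea) (use x in auto)
  thus ?thesis by simp
qed

text \<open>The image of \<open>w^k\<close> under the element for -r is \<open>G\<close>; applying
  the element for r returns \<open>u^k\<close>. Comparing Taylor coefficients shows that the two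
  matrices are inverse.\<close>

lemma ds_coeff_inverse_sums:
  "(\<lambda>m. ds_coeff p r n m * ds_coeff p (- r) m k) sums (if n = k then 1 else 0)"
proof -
  define g where "g = (\<lambda>m. complex_of_real (ds_coeff p (- r) m k))"
  define G where "G = (\<lambda>w. (of_real (cosh r) * w + of_real (sinh r)) ^ k /
            (of_real (cosh r) + of_real (sinh r) * w :: complex) ^ (Suc p + k))"
  have G: "(\<lambda>m. g m * w ^ m) sums G w" if "norm w < 1" for w
    using ds_coeff_sums[OF boost_in_disk(2)[OF that, of "- r"], of p k] by (simp add: g_def G_def)
  define C where "C = (\<Sum>m. norm (g m))"
  have g: "summable (\<lambda>m. norm (g m))"
    using summable_ds_coeff_column by (simp add: g_def)
  have le: "\<bar>ds_coeff p r n m\<bar> * norm (g m) \<le> 1 / monom_norm_sq p n * norm (g m)" for n m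
    by (intro mult_right_mono abs_ds_coeff_le) auto
  have summ: "summable (\<lambda>m. \<bar>ds_coeff p r n m\<bar> * norm (g m))" for n
    by (rule summable_comparison_test'[OF summable_mult[OF g, of "1 / monom_norm_sq p n"], of 0])
       (use le[of n] in simp)
  have bnd: "(\<Sum>m. \<bar>ds_coeff p r n m\<bar> * norm (g m)) \<le> C / monom_norm_sq p n" for n
  proof -
    have "(\<Sum>m. \<bar>ds_coeff p r n m\<bar> * norm (g m)) \<le> (\<Sum>m. 1 / monom_norm_sq p n * norm (g m))"
      by (intro suminf_le le summ summable_mult g)
    also have "\<dots> = 1 / monom_norm_sq p n * C"
      unfolding C_def by (rule suminf_mult[OF g])
    finally show ?thesis by simp
  qed
  have "(\<lambda>n. ((\<Sum>m. of_real (ds_coeff p r n m) * g m) - (if n = k then 1 else 0)) * u ^ n) sums 0"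
    if u: "norm u < 1" for u
  proof -
    define D where "D = of_real (cosh r) - of_real (sinh r) * u"
    have D: "D \<noteq> 0" unfolding D_def by (rule cosh_minus_nonzero[OF boost_in_disk(2)[OF u]])
    define w where "w = (of_real (cosh r) * u - of_real (sinh r)) / D"
    have cs: "complex_of_real ((cosh r)\<^sup>2 - (sinh r)\<^sup>2) = 1"
      using cosh_square_eq[of r] by simp
    have w: "w * D = of_real (cosh r) * u - of_real (sinh r)" using D by (simp add: w_def)
    have "(of_real (cosh r) * w + of_real (sinh r)) * D = of_real ((cosh r)\<^sup>2 - (sinh r)\<^sup>2) * u"
      unfolding distrib_right mult.assoc w by (simp add: D_def power2_eq_square algebra_simps)
    hence 1: "of_real (cosh r) * w + of_real (sinh r) = u / D"
      using D cs by (simp add: field_simps)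
    have "(of_real (cosh r) + of_real (sinh r) * w) * D = of_real ((cosh r)\<^sup>2 - (sinh r)\<^sup>2)"
      unfolding distrib_right mult.assoc w by (simp add: D_def power2_eq_square algebra_simps)
    hence 2: "of_real (cosh r) + of_real (sinh r) * w = 1 / D"
      using D cs by (simp add: field_simps)
    \<comment> \<open>The factors of D coming from both elements cancel: by 1 and 2,
      \<open>G w\<close> is \<open>(u / D)^k\<close> times \<open>D^(p + 1 + k)\<close>.\<close>
    have "G w / D ^ Suc p = u ^ k"
      using D unfolding G_def 1 2 by (simp add: power_divide power_add field_simps)
    hence *: "(\<lambda>n. (\<Sum>m. of_real (ds_coeff p r n m) * g m) * u ^ n) sums u ^ k"
      using ds_coeff_transform_sums[OF G summ bnd u]
      unfolding D_def[symmetric] w_def[symmetric] by simp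
    have "(\<lambda>n. (if n = k then 1 else 0) * u ^ n) sums u ^ k"
    proof -
      have "(\<lambda>n. (if n = k then 1 else 0) * u ^ n) = (\<lambda>n. if n = k then u ^ n else 0)"
        by auto
      thus ?thesis by (simp only: sums_single)
    qed
    from sums_diff[OF * this] show ?thesis by (simp add: left_diff_distrib)
  qed
  from powser_coeffs_zero[OF this, of n]
  have "(\<Sum>m. of_real (ds_coeff p r n m) * g m) = (if n = k then 1 else 0)" by simp
  moreover have "summable (\<lambda>m. of_real (ds_coeff p r n m) * g m)"
    by (rule summable_norm_cancel) (simp add: norm_mult summ)
  ultimately have "(\<lambda>m. of_real (ds_coeff p r n m) * g m) sums of_real (if n = k then 1 else 0)"
    by (simp add: sums_iff)
  hence "(\<lambda>m. complex_of_real (ds_coeff p r n m * ds_coeff p (- r) m k)) sums of_real (if n = k then 1 else 0)"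
    by (simp add: g_def)
  thus ?thesis by (simp only: sums_of_real_iff)
qed

text \<open>Inverse and adjoint coincide, so the columns are orthogonal in the weighted space, with
  the norms of the monomials.\<close>

lemma ds_coeff_orthogonal:
  "(\<lambda>m. monom_norm_sq p m * ds_coeff p r m n * ds_coeff p r m k) sums (if n = k then monom_norm_sq p k else 0)"
proof -
  have "(\<lambda>m. monom_norm_sq p n * (ds_coeff p (- r) n m * ds_coeff p r m k)) sums (monom_norm_sq p n * (if n = k then 1 else 0))"
    using ds_coeff_inverse_sums[of p "- r" n k] by (intro sums_mult) simp
  moreover have "monom_norm_sq p n * (ds_coeff p (- r) n m * ds_coeff p r m k) =
      monom_norm_sq p m * ds_coeff p r m n * ds_coeff p r m k" for m
  proof -
    have "monom_norm_sq p n * ds_coeff p (- r) n m = monom_norm_sq p m * ds_coeff p r m n"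
      using ds_coeff_symmetric[of p n "- r" m] by (simp only: minus_minus)
    thus ?thesis by (simp only: mult.assoc[symmetric])
  qed
  moreover have "monom_norm_sq p n * (if n = k then 1 else 0) = (if n = k then monom_norm_sq p k else 0)"
    by simp
  ultimately show ?thesis by (simp only:)
qed

text \<open>The dual relation for a single row, obtained from a column for -r. It makes each row a
  bounded functional on the weighted space.\<close>

lemma ds_coeff_row:
  "(\<lambda>m. (ds_coeff p r n m)\<^sup>2 / monom_norm_sq p m) sums (1 / monom_norm_sq p n)"
proof -
  have "(ds_coeff p r n m)\<^sup>2 / monom_norm_sq p m =
     (monom_norm_sq p m * ds_coeff p (- r) m n * ds_coeff p (- r) m n) / (monom_norm_sq p n)\<^sup>2" for m
  proof -
    have "(monom_norm_sq p n)\<^sup>2 * (ds_coeff p r n m)\<^sup>2 = (monom_norm_sq p m)\<^sup>2 * (ds_coeff p (- r) m n)\<^sup>2"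
      by (simp only: ds_coeff_symmetric[of p n r m] flip: power_mult_distrib)
    thus ?thesis
      by (subst frac_eq_eq) (simp_all only: monom_norm_sq_nonzero power2_eq_square mult_ac, simp_all)
  qed
  thus ?thesis
    using sums_divide[OF ds_coeff_orthogonal[of p "- r" n n], of "(monom_norm_sq p n)\<^sup>2"]
    by (simp add: power2_eq_square)
qed

context
  fixes p :: nat and r :: real and g :: "nat \<Rightarrow> complex"
  assumes g: "summable (\<lambda>m. (norm (g m))\<^sup>2 * monom_norm_sq p m)"
begin

lemma abs_ds_coeff_mult_le:
  "\<bar>ds_coeff p r n m\<bar> * norm (g m) \<le>
     (ds_coeff p r n m)\<^sup>2 / monom_norm_sq p m + (norm (g m))\<^sup>2 * monom_norm_sq p m"
proof -
  define h where "h = monom_norm_sq p m"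
  have h: "h > 0" by (simp add: h_def)
  have sq: "x * y \<le> x\<^sup>2 + y\<^sup>2" for x y :: real
    using sum_squares_bound[of x y] zero_le_power2[of x] zero_le_power2[of y] by linarith
  have "\<bar>ds_coeff p r n m\<bar> * norm (g m) = (\<bar>ds_coeff p r n m\<bar> / sqrt h) * (norm (g m) * sqrt h)"
    using h by simp
  also have "\<dots> \<le> (\<bar>ds_coeff p r n m\<bar> / sqrt h)\<^sup>2 + (norm (g m) * sqrt h)\<^sup>2"
    by (rule sq)
  also have "\<dots> = (ds_coeff p r n m)\<^sup>2 / h + (norm (g m))\<^sup>2 * h"
    using h by (simp add: power_divide power_mult_distrib)
  finally show ?thesis by (simp add: h_def)
qed

lemma summable_ds_coeff_mult: "summable (\<lambda>m. \<bar>ds_coeff p r n m\<bar> * norm (g m))"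
  by (rule summable_comparison_test'[OF summable_add[OF sums_summable[OF ds_coeff_row[of p r n]] g], of 0])
     (use abs_ds_coeff_mult_le[of n] in simp)

text \<open>Supplies the constant C required by \<open>ds_coeff_transform_sums\<close>. Its size
  does not matter, hence the crude inequality xy \<le> x^2 + y^2 in place of Cauchy-Schwarz.\<close>

lemma suminf_ds_coeff_mult_le:
  "(\<Sum>m. \<bar>ds_coeff p r n m\<bar> * norm (g m)) \<le>
     (1 + (\<Sum>m. (norm (g m))\<^sup>2 * monom_norm_sq p m)) / monom_norm_sq p n"
proof -
  have "(\<Sum>m. \<bar>ds_coeff p r n m\<bar> * norm (g m)) \<le>
     (\<Sum>m. (ds_coeff p r n m)\<^sup>2 / monom_norm_sq p m + (norm (g m))\<^sup>2 * monom_norm_sq p m)"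
    by (intro suminf_le summable_ds_coeff_mult abs_ds_coeff_mult_le summable_add g
          sums_summable[OF ds_coeff_row])
  also have "\<dots> = 1 / monom_norm_sq p n + (\<Sum>m. (norm (g m))\<^sup>2 * monom_norm_sq p m)"
    using suminf_add[OF sums_summable[OF ds_coeff_row[of p r n]] g] sums_unique[OF ds_coeff_row[of p r n]]
    by simp
  also have "\<dots> \<le> 1 / monom_norm_sq p n + (\<Sum>m. (norm (g m))\<^sup>2 * monom_norm_sq p m) / monom_norm_sq p n"
  proof -
    have "(\<Sum>m. (norm (g m))\<^sup>2 * monom_norm_sq p m) / 1 \<le>
       (\<Sum>m. (norm (g m))\<^sup>2 * monom_norm_sq p m) / monom_norm_sq p n"
      by (intro divide_left_mono monom_norm_sq_le_1 suminf_nonneg g) auto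
    thus ?thesis by simp
  qed
  finally show ?thesis by (simp add: add_divide_distrib)
qed

text \<open>For a finitely supported sequence, orthogonality of the columns gives an isometry;
  truncating at M and letting M grow with K fixed keeps the inequality. The sum over n stays finite
  because its convergence is first deduced from this bound.\<close>

lemma ds_coeff_bessel:
  "(\<Sum>n<K. (norm (\<Sum>m. of_real (ds_coeff p r n m) * g m))\<^sup>2 * monom_norm_sq p n) \<le>
     (\<Sum>m. (norm (g m))\<^sup>2 * monom_norm_sq p m)"
proof (rule LIMSEQ_le_const2)
  have "summable (\<lambda>m. of_real (ds_coeff p r n m) * g m)" for n
    by (rule summable_norm_cancel) (simp add: norm_mult summable_ds_coeff_mult)
  thus "(\<lambda>M. \<Sum>n<K. (norm (\<Sum>m<M. of_real (ds_coeff p r n m) * g m))\<^sup>2 * monom_norm_sq p n)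
     \<longlonglongrightarrow> (\<Sum>n<K. (norm (\<Sum>m. of_real (ds_coeff p r n m) * g m))\<^sup>2 * monom_norm_sq p n)"
    by (intro tendsto_intros summable_LIMSEQ)
  show "\<exists>N. \<forall>M\<ge>N. (\<Sum>n<K. (norm (\<Sum>m<M. of_real (ds_coeff p r n m) * g m))\<^sup>2 * monom_norm_sq p n)
     \<le> (\<Sum>m. (norm (g m))\<^sup>2 * monom_norm_sq p m)"
  proof (intro exI allI impI)
    fix M
    define x where "x = (\<lambda>n. (norm (\<Sum>m<M. of_real (ds_coeff p r n m) * g m))\<^sup>2 * monom_norm_sq p n)"
    have "(\<lambda>n. \<Sum>m<M. \<Sum>k<M. of_real (monom_norm_sq p n * ds_coeff p r n m * ds_coeff p r n k) * (g m * cnj (g k))) sums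
       (\<Sum>m<M. \<Sum>k<M. of_real (if m = k then monom_norm_sq p k else 0) * (g m * cnj (g k)))"
      by (intro sums_sum sums_mult2 sums_of_real ds_coeff_orthogonal)
    also have "(\<lambda>n. \<Sum>m<M. \<Sum>k<M. of_real (monom_norm_sq p n * ds_coeff p r n m * ds_coeff p r n k) * (g m * cnj (g k)))
       = (\<lambda>n. complex_of_real (x n))"
      unfolding x_def of_real_mult complex_norm_square
      by (subst sum.swap) (simp add: sum_product sum_distrib_left sum_distrib_right mult_ac)
    also have "(\<Sum>m<M. \<Sum>k<M. of_real (if m = k then monom_norm_sq p k else 0) * (g m * cnj (g k))) =
       of_real (\<Sum>m<M. (norm (g m))\<^sup>2 * monom_norm_sq p m)"
      unfolding of_real_sum of_real_mult complex_norm_square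
      by (simp add: if_distrib[of complex_of_real] if_distrib[of "\<lambda>x. x * _"] if_distrib[of "(*) a" for a] mult_ac cong: if_cong)
    finally have x: "x sums (\<Sum>m<M. (norm (g m))\<^sup>2 * monom_norm_sq p m)"
      by (simp only: sums_of_real_iff)
    have "sum x {..<K} \<le> (\<Sum>n. x n)"
      by (rule sum_le_suminf[OF sums_summable[OF x]]) (auto simp: x_def)
    also have "\<dots> \<le> (\<Sum>m. (norm (g m))\<^sup>2 * monom_norm_sq p m)"
      using x by (auto simp: sums_iff intro!: sum_le_suminf g)
    finally show "(\<Sum>n<K. (norm (\<Sum>m<M. of_real (ds_coeff p r n m) * g m))\<^sup>2 * monom_norm_sq p n)
     \<le> (\<Sum>m. (norm (g m))\<^sup>2 * monom_norm_sq p m)" by (simp add: x_def)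
  qed
qed

end

section \<open>Parseval's identity\<close>

lemma bounded_convergence_interval:
  fixes s :: "nat \<Rightarrow> real \<Rightarrow> real" and f :: "real \<Rightarrow> real"
  assumes s: "\<And>i. set_integrable lborel {a..b} (s i)"
    and lim: "\<And>x. x \<in> {a..b} \<Longrightarrow> (\<lambda>i. s i x) \<longlonglongrightarrow> f x"
    and bnd: "\<And>i x. x \<in> {a..b} \<Longrightarrow> \<bar>s i x\<bar> \<le> C"
  shows "set_integrable lborel {a..b} f"
    and "(\<lambda>i. LBINT x:{a..b}. s i x) \<longlonglongrightarrow> (LBINT x:{a..b}. f x)"
proof -
  have s': "(\<lambda>x. indicat_real {a..b} x *\<^sub>R s i x) \<in> borel_measurable lborel" for i
    using s[of i] unfolding set_integrable_def by (rule borel_measurable_integrable)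
  have lim': "(\<lambda>i. indicat_real {a..b} x *\<^sub>R s i x) \<longlonglongrightarrow> indicat_real {a..b} x *\<^sub>R f x" for x
    using lim[of x] by (cases "x \<in> {a..b}") auto
  have f': "(\<lambda>x. indicat_real {a..b} x *\<^sub>R f x) \<in> borel_measurable lborel"
    by (rule borel_measurable_LIMSEQ_metric[OF s' lim'])
  have C: "integrable lborel (\<lambda>x. indicat_real {a..b} x *\<^sub>R C)"
    using borel_integrable_atLeastAtMost'[of a b "\<lambda>_. C"] by (simp add: set_integrable_def)
  have le: "AE x in lborel. norm (indicat_real {a..b} x *\<^sub>R s i x) \<le> indicat_real {a..b} x *\<^sub>R C" for i
    using bnd by (auto simp: indicator_def)
  note * = f' s' C AE_I2[OF lim'] le
  show "set_integrable lborel {a..b} f"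
    unfolding set_integrable_def by (rule integrable_dominated_convergence[OF *])
  show "(\<lambda>i. LBINT x:{a..b}. s i x) \<longlonglongrightarrow> (LBINT x:{a..b}. f x)"
    unfolding set_lebesgue_integral_def by (rule integral_dominated_convergence[OF *])
qed

lemma integral_cis:
  "(LBINT \<theta>:{-pi..pi}. cis (of_int j * \<theta>)) = (if j = 0 then of_real (2 * pi) else 0)"
proof (cases "j = 0")
  case False
  have cont: "continuous_on {-pi..pi} (\<lambda>\<theta>. cis (of_int j * \<theta>))"
    by (intro continuous_intros)
  have "((\<lambda>\<theta>. cis (of_int j * \<theta>)) has_integral
      (cis (of_int j * pi) / (\<i> * of_int j) - cis (of_int j * (- pi)) / (\<i> * of_int j))) {-pi..pi}"
  proof (rule fundamental_theorem_of_calculus)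
    fix x :: real
    have "((\<lambda>w. exp (\<i> * (of_int j * w)) / (\<i> * of_int j)) has_field_derivative
        exp (\<i> * (of_int j * of_real x))) (at (of_real x))"
      using False by (auto intro!: derivative_eq_intros simp: mult_ac)
    from has_vector_derivative_real_field[OF this]
    show "((\<lambda>x. cis (of_int j * x) / (\<i> * of_int j)) has_vector_derivative cis (of_int j * x)) (at x within {-pi..pi})"
      by (simp add: cis_conv_exp)
  qed simp
  moreover have "cis (of_int j * pi) = cis (of_int j * (- pi))"
    by (simp add: complex_eq_iff mult.commute)
  ultimately have "((\<lambda>\<theta>. cis (of_int j * \<theta>)) has_integral 0) {-pi..pi}"
    by simp
  thus ?thesis
    using False set_borel_integral_eq_integral(2)[OF borel_integrable_atLeastAtMost'[OF cont]]
    by (simp add: integral_unique)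
qed (simp add: set_integral_const scaleR_conv_of_real)

lemma set_lebesgue_integral_sum:
  fixes f :: "'i \<Rightarrow> 'a \<Rightarrow> 'b :: {banach, second_countable_topology}"
  assumes "\<And>i. i \<in> I \<Longrightarrow> set_integrable M A (f i)"
  shows "set_integrable M A (\<lambda>x. \<Sum>i\<in>I. f i x)"
    and "set_lebesgue_integral M A (\<lambda>x. \<Sum>i\<in>I. f i x) = (\<Sum>i\<in>I. set_lebesgue_integral M A (f i))"
  using assms unfolding set_integrable_def set_lebesgue_integral_def scaleR_sum_right
  by (auto intro!: Bochner_Integration.integrable_sum Bochner_Integration.integral_sum)

lemma parseval_finite:
  fixes p :: "nat \<Rightarrow> complex" and j :: int
  assumes "j \<noteq> 0"
  shows "(LBINT \<theta>:{-pi..pi}. (cmod (\<Sum>n<K. p n * cis (of_int j * \<theta>) ^ n))\<^sup>2) =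
           2 * pi * (\<Sum>n<K. (cmod (p n))\<^sup>2)"
proof -
  have int: "set_integrable lborel {-pi..pi} (\<lambda>\<theta>. p n * cnj (p m) * cis (of_int (j * (int n - int m)) * \<theta>))" for n m
    by (intro borel_integrable_atLeastAtMost' continuous_intros)
  have "complex_of_real (LBINT \<theta>:{-pi..pi}. (cmod (\<Sum>n<K. p n * cis (of_int j * \<theta>) ^ n))\<^sup>2) =
     (LBINT \<theta>:{-pi..pi}. complex_of_real ((cmod (\<Sum>n<K. p n * cis (of_int j * \<theta>) ^ n))\<^sup>2))"
    by (rule set_integral_complex_of_real[symmetric])
  also have "(\<lambda>\<theta>. complex_of_real ((cmod (\<Sum>n<K. p n * cis (of_int j * \<theta>) ^ n))\<^sup>2)) =
     (\<lambda>\<theta>. \<Sum>n<K. \<Sum>m<K. p n * cnj (p m) * cis (of_int (j * (int n - int m)) * \<theta>))"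
  proof
    fix \<theta>
    have "cis (of_int j * \<theta>) ^ n * cnj (cis (of_int j * \<theta>) ^ m) = cis (of_int (j * (int n - int m)) * \<theta>)" for n m
      by (simp add: Complex.DeMoivre cis_cnj cis_mult algebra_simps)
    hence eq: "p n * cis (of_int j * \<theta>) ^ n * cnj (p m * cis (of_int j * \<theta>) ^ m) =
        p n * cnj (p m) * cis (of_int (j * (int n - int m)) * \<theta>)" for n m
      by (metis (no_types) complex_cnj_mult mult.assoc mult.left_commute)
    show "complex_of_real ((cmod (\<Sum>n<K. p n * cis (of_int j * \<theta>) ^ n))\<^sup>2) =
       (\<Sum>n<K. \<Sum>m<K. p n * cnj (p m) * cis (of_int (j * (int n - int m)) * \<theta>))"
      unfolding complex_norm_square cnj_sum sum_product eq ..
  qed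
  also have "(LBINT \<theta>:{-pi..pi}. \<Sum>n<K. \<Sum>m<K. p n * cnj (p m) * cis (of_int (j * (int n - int m)) * \<theta>)) =
     (\<Sum>n<K. \<Sum>m<K. LBINT \<theta>:{-pi..pi}. p n * cnj (p m) * cis (of_int (j * (int n - int m)) * \<theta>))"
    by (simp only: set_lebesgue_integral_sum int)
  also have "\<dots> = (\<Sum>n<K. \<Sum>m<K. p n * cnj (p m) * (if n = m then of_real (2 * pi) else 0))"
    using assms by (simp add: set_integral_mult_right integral_cis del: of_int_mult of_int_diff)
  also have "\<dots> = (\<Sum>n<K. p n * cnj (p n) * of_real (2 * pi))"
    by (intro sum.cong refl) (simp add: if_distrib[of "(*) a" for a] cong: if_cong)
  also have "\<dots> = complex_of_real (2 * pi * (\<Sum>n<K. (cmod (p n))\<^sup>2))"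
    unfolding of_real_mult of_real_sum complex_norm_square
    by (simp add: sum_distrib_left mult_ac)
  finally show ?thesis by (simp only: of_real_eq_iff)
qed

text \<open>Absolute summability bounds the partial sums uniformly, so bounded convergence applies.
  The step j between frequencies is 1 for circles in the disk and -2 or 2 for the group angles, as
  \<open>k_tilde\<close> rotates the disk by twice its angle.\<close>

lemma parseval:
  fixes p :: "nat \<Rightarrow> complex" and j :: int
  assumes "j \<noteq> 0" and p: "summable (\<lambda>n. cmod (p n))"
  shows "set_integrable lborel {-pi..pi} (\<lambda>\<theta>. (cmod (\<Sum>n. p n * cis (of_int j * \<theta>) ^ n))\<^sup>2)"
    and "(\<lambda>n. (cmod (p n))\<^sup>2) sums ((LBINT \<theta>:{-pi..pi}. (cmod (\<Sum>n. p n * cis (of_int j * \<theta>) ^ n))\<^sup>2) / (2 * pi))"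
proof -
  define s where "s = (\<lambda>K \<theta>. (cmod (\<Sum>n<K. p n * cis (of_int j * \<theta>) ^ n))\<^sup>2)"
  have 1: "set_integrable lborel {-pi..pi} (s K)" for K
    unfolding s_def by (intro borel_integrable_atLeastAtMost' continuous_intros)
  have norm_eq: "cmod (p n * cis (of_int j * \<theta>) ^ n) = cmod (p n)" for n \<theta>
    by (simp add: norm_mult norm_power)
  have 2: "(\<lambda>K. s K \<theta>) \<longlonglongrightarrow> (cmod (\<Sum>n. p n * cis (of_int j * \<theta>) ^ n))\<^sup>2" for \<theta>
    unfolding s_def
    by (intro tendsto_intros summable_LIMSEQ) (rule summable_norm_cancel, simp only: norm_eq p)
  have 3: "\<bar>s K \<theta>\<bar> \<le> (\<Sum>n. cmod (p n))\<^sup>2" for K \<theta>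
  proof -
    have "cmod (\<Sum>n<K. p n * cis (of_int j * \<theta>) ^ n) \<le> (\<Sum>n<K. cmod (p n))"
      by (rule order_trans[OF norm_sum]) (simp only: norm_eq order_refl)
    also have "\<dots> \<le> (\<Sum>n. cmod (p n))"
      by (rule sum_le_suminf[OF p]) auto
    finally show ?thesis by (simp add: s_def power_mono)
  qed
  show "set_integrable lborel {-pi..pi} (\<lambda>\<theta>. (cmod (\<Sum>n. p n * cis (of_int j * \<theta>) ^ n))\<^sup>2)"
    by (rule bounded_convergence_interval(1)[OF 1 2 3])
  have "(\<lambda>K. LBINT \<theta>:{-pi..pi}. s K \<theta>) \<longlonglongrightarrow> (LBINT \<theta>:{-pi..pi}. (cmod (\<Sum>n. p n * cis (of_int j * \<theta>) ^ n))\<^sup>2)"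
    by (rule bounded_convergence_interval(2)[OF 1 2 3])
  hence "(\<lambda>K. 2 * pi * (\<Sum>n<K. (cmod (p n))\<^sup>2)) \<longlonglongrightarrow> (LBINT \<theta>:{-pi..pi}. (cmod (\<Sum>n. p n * cis (of_int j * \<theta>) ^ n))\<^sup>2)"
    unfolding s_def parseval_finite[OF assms(1)] .
  from tendsto_divide[OF this tendsto_const[of "2 * pi"]]
  show "(\<lambda>n. (cmod (p n))\<^sup>2) sums ((LBINT \<theta>:{-pi..pi}. (cmod (\<Sum>n. p n * cis (of_int j * \<theta>) ^ n))\<^sup>2) / (2 * pi))"
    by (simp add: sums_def)
qed

section \<open>Area integrals over the disk\<close>

text \<open>Lebesgue measure is determined by the volumes of boxes. The identification makes Tonelli
  available in the coordinates Re and Im.\<close>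

lemma lborel_complex_eq:
  "(lborel :: complex measure) = distr (lborel \<Otimes>\<^sub>M lborel) borel (\<lambda>(x, y). Complex x y)"
proof (rule lborel_eqI)
  have [measurable]: "(\<lambda>(x, y). Complex x y) \<in> borel_measurable (lborel \<Otimes>\<^sub>M lborel)"
    by (simp add: case_prod_unfold Complex_eq)
  fix l u :: complex
  assume le: "\<And>b. b \<in> Basis \<Longrightarrow> l \<bullet> b \<le> u \<bullet> b"
  have le': "Re l \<le> Re u" "Im l \<le> Im u"
    using le[of 1] le[of \<i>] by (auto simp: Basis_complex_def inner_complex_def)
  have "emeasure (distr (lborel \<Otimes>\<^sub>M lborel) borel (\<lambda>(x, y). Complex x y)) (box l u) =
     emeasure (lborel \<Otimes>\<^sub>M lborel) ({Re l<..<Re u} \<times> {Im l<..<Im u})"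
    by (subst emeasure_distr) 
       (auto simp: in_box_complex_iff space_pair_measure intro!: arg_cong[where f = "emeasure _"])
  also have "\<dots> = (\<Prod>b\<in>Basis. (u - l) \<bullet> b)"
    using le' by (subst lborel.emeasure_pair_measure_Times)
       (auto simp: Basis_complex_def inner_complex_def ennreal_mult'')
  finally show "emeasure (distr (lborel \<Otimes>\<^sub>M lborel) borel (\<lambda>(x, y). Complex x y)) (box l u) =
     (\<Prod>b\<in>Basis. (u - l) \<bullet> b)" .
qed simp

lemma nn_integral_complex:
  assumes [measurable]: "f \<in> borel_measurable borel"
  shows "(\<integral>\<^sup>+z. f z \<partial>lborel) = (\<integral>\<^sup>+x. \<integral>\<^sup>+y. f (Complex x y) \<partial>lborel \<partial>lborel)"
    and "(\<integral>\<^sup>+z. f z \<partial>lborel) = (\<integral>\<^sup>+y. \<integral>\<^sup>+x. f (Complex x y) \<partial>lborel \<partial>lborel)"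
proof -
  have [measurable]: "(\<lambda>(x, y). Complex x y) \<in> borel_measurable (lborel \<Otimes>\<^sub>M lborel)"
    by (simp add: case_prod_unfold Complex_eq)
  have [measurable]: "(\<lambda>z. f (case z of (x, y) \<Rightarrow> Complex x y)) \<in> borel_measurable (lborel \<Otimes>\<^sub>M lborel)"
    by measurable
  have "(\<integral>\<^sup>+z. f z \<partial>lborel) = (\<integral>\<^sup>+z. f (case z of (x, y) \<Rightarrow> Complex x y) \<partial>(lborel \<Otimes>\<^sub>M lborel))"
    by (subst lborel_complex_eq, subst nn_integral_distr) auto
  thus "(\<integral>\<^sup>+z. f z \<partial>lborel) = (\<integral>\<^sup>+x. \<integral>\<^sup>+y. f (Complex x y) \<partial>lborel \<partial>lborel)"
    and "(\<integral>\<^sup>+z. f z \<partial>lborel) = (\<integral>\<^sup>+y. \<integral>\<^sup>+x. f (Complex x y) \<partial>lborel \<partial>lborel)"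
    using lborel_pair.nn_integral_snd[of "\<lambda>z. f (case z of (x, y) \<Rightarrow> Complex x y)"]
      lborel.nn_integral_fst[of "\<lambda>z. f (case z of (x, y) \<Rightarrow> Complex x y)" lborel]
    by simp_all
qed

text \<open>For \<open>Re c \<noteq> 0\<close> the rotation by \<open>c\<close> is a composition of affine substitutions in one coordinate at a
  time, so that Fubini suffices; a rotation by \<open>\<plusminus>\<i>\<close> is the square of such a rotation.\<close>

lemma nn_integral_rotate_aux:
  fixes c :: complex
  assumes [measurable]: "f \<in> borel_measurable borel" and c: "norm c = 1" "Re c \<noteq> 0"
  shows "(\<integral>\<^sup>+z. f (c * z) \<partial>lborel) = (\<integral>\<^sup>+z. f z \<partial>lborel)"
proof -
  define a b where "a = Re c" and "b = Im c"
  have a: "a \<noteq> 0" using c by (simp add: a_def)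
  have ab: "a * a + b * b = 1"
    using c(1) by (simp add: a_def b_def cmod_def power2_eq_square)
  have C: "Complex = (\<lambda>x y. of_real x + \<i> * of_real y)" by (simp add: fun_eq_iff Complex_eq)
  have [measurable]: "(\<lambda>x. f (Complex x (g x y))) \<in> borel_measurable borel"
    if "(\<lambda>x. g x y) \<in> borel_measurable borel" for y g
    using that unfolding C by measurable
  have inner: "ennreal \<bar>a\<bar> * (\<integral>\<^sup>+x. f (c * Complex x y) \<partial>lborel) =
      (\<integral>\<^sup>+x. f (Complex x (b / a * x + 1 / a * y)) \<partial>lborel)" for y
  proof -
    \<comment> \<open>With y fixed, the real part a x - b y of the rotated point becomes the new
      variable; since a \<noteq> 0, the imaginary part is affine in it and in y.\<close>
    have "c * Complex x y = Complex (- b * y + a * x) (b / a * (- b * y + a * x) + 1 / a * y)" for x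
    proof -
      have "b / a * (- b * y + a * x) + 1 / a * y = (a * (b * x) + (1 - b * b) * y) / a"
        using a by (simp add: field_simps)
      also have "1 - b * b = a * a" using ab by simp
      also have "(a * (b * x) + a * a * y) / a = b * x + a * y"
        using a by (simp add: field_simps)
      finally show ?thesis by (simp add: complex_eq_iff a_def b_def)
    qed
    thus ?thesis
      by (subst (2) nn_integral_real_affine[of _ a "- b * y"]) (use a in auto)
  qed
  have "ennreal \<bar>a\<bar> * (\<integral>\<^sup>+z. f (c * z) \<partial>lborel) =
      (\<integral>\<^sup>+y. ennreal \<bar>a\<bar> * (\<integral>\<^sup>+x. f (c * Complex x y) \<partial>lborel) \<partial>lborel)"
    by (subst nn_integral_complex(2)) (auto simp: C intro!: nn_integral_cmult[symmetric])
  also have "\<dots> = (\<integral>\<^sup>+y. \<integral>\<^sup>+x. f (Complex x (b / a * x + 1 / a * y)) \<partial>lborel \<partial>lborel)"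
    by (simp only: inner)
  also have "\<dots> = (\<integral>\<^sup>+x. \<integral>\<^sup>+y. f (Complex x (b / a * x + 1 / a * y)) \<partial>lborel \<partial>lborel)"
    unfolding C by (rule lborel_pair.Fubini') measurable
  also have "\<dots> = (\<integral>\<^sup>+x. ennreal \<bar>a\<bar> * (\<integral>\<^sup>+y. f (Complex x y) \<partial>lborel) \<partial>lborel)"
  proof (intro nn_integral_cong)
    fix x
    have [measurable]: "(\<lambda>y. f (Complex x y)) \<in> borel_measurable borel"
      unfolding C by measurable
    have "(\<integral>\<^sup>+y. f (Complex x y) \<partial>lborel) = ennreal \<bar>1 / a\<bar> * (\<integral>\<^sup>+y. f (Complex x (b / a * x + 1 / a * y)) \<partial>lborel)"
      by (rule nn_integral_real_affine) (use a in auto)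
    hence "ennreal \<bar>a\<bar> * (\<integral>\<^sup>+y. f (Complex x y) \<partial>lborel) =
       (ennreal \<bar>a\<bar> * ennreal \<bar>1 / a\<bar>) * (\<integral>\<^sup>+y. f (Complex x (b / a * x + 1 / a * y)) \<partial>lborel)"
      by (simp only: mult.assoc)
    also have "ennreal \<bar>a\<bar> * ennreal \<bar>1 / a\<bar> = 1"
      using a by (simp flip: ennreal_mult)
    finally show "(\<integral>\<^sup>+y. f (Complex x (b / a * x + 1 / a * y)) \<partial>lborel) =
       ennreal \<bar>a\<bar> * (\<integral>\<^sup>+y. f (Complex x y) \<partial>lborel)" by simp
  qed
  also have "\<dots> = ennreal \<bar>a\<bar> * (\<integral>\<^sup>+z. f z \<partial>lborel)"
    by (subst nn_integral_complex(1)) (auto simp: C intro!: nn_integral_cmult)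
  finally show ?thesis
    using a by (simp add: ennreal_mult_cancel_left)
qed

lemma nn_integral_rotate:
  fixes c :: complex
  assumes [measurable]: "f \<in> borel_measurable borel" and c: "norm c = 1"
  shows "(\<integral>\<^sup>+z. f (c * z) \<partial>lborel) = (\<integral>\<^sup>+z. f z \<partial>lborel)"
proof (cases "Re c = 0")
  case True
  define d where "d = csqrt c"
  have dd: "d * d = c" by (simp add: d_def flip: power2_eq_square)
  have d: "norm d = 1" using c by (simp add: d_def norm_csqrt)
  have "Re d \<noteq> 0"
  proof
    assume "Re d = 0"
    moreover have "Re c = Re d * Re d - Im d * Im d" by (simp flip: dd)
    ultimately have "d = 0" using True by (simp add: complex_eq_iff)
    thus False using d by simp
  qed
  hence "(\<integral>\<^sup>+z. f (d * (d * z)) \<partial>lborel) = (\<integral>\<^sup>+z. f z \<partial>lborel)"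
    using nn_integral_rotate_aux[of f d] nn_integral_rotate_aux[of "\<lambda>z. f (d * z)" d] d by simp
  thus ?thesis by (simp add: dd flip: mult.assoc)
qed (use nn_integral_rotate_aux[of f c] c in auto)

text \<open>The image of area measure on the disk under the squared modulus is \<pi> times Lebesgue
  measure on (0, 1), because the annulus above level x has area \<pi> (1 - x). Comparing both
  measures on half-lines replaces polar coordinates.\<close>

lemma nn_integral_disk_radial:
  fixes g :: "real \<Rightarrow> ennreal"
  assumes [measurable]: "g \<in> borel_measurable borel"
  shows "(\<integral>\<^sup>+z\<in>ball (0 :: complex) 1. g ((norm z)\<^sup>2) \<partial>lborel) = ennreal pi * (\<integral>\<^sup>+t\<in>{0<..<1}. g t \<partial>lborel)"
proof -
  define M where "M = distr (density lborel (indicator (ball (0 :: complex) 1))) borel (\<lambda>z. (norm z)\<^sup>2)"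
  define N where "N = density lborel (\<lambda>t. ennreal pi * indicator {0<..<1::real} t)"
  have vol: "emeasure lborel (cball (0 :: complex) r) = ennreal (pi * r\<^sup>2)"
    "emeasure lborel (ball (0 :: complex) r) = ennreal (pi * r\<^sup>2)" if "r \<ge> 0" for r
    using that by (simp_all add: emeasure_cball emeasure_ball unit_ball_vol_2)
  have M: "emeasure M {x<..} = emeasure lborel (ball (0 :: complex) 1 \<inter> {z. x < (norm z)\<^sup>2})" for x
  proof -
    have "{z :: complex. x < (norm z)\<^sup>2} \<in> sets borel"
      by measurable
    thus ?thesis
      unfolding M_def by (subst emeasure_distr) (auto simp: vimage_def emeasure_restricted)
  qed
  have N: "emeasure N {x<..} = ennreal pi * emeasure lborel ({0<..<1} \<inter> {x<..})" for x
    unfolding N_def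
    by (auto simp: emeasure_density mult.assoc nn_integral_cmult indicator_inter_arith[symmetric])
  have "M = N"
  proof (rule measure_eqI_lessThan)
    show "sets M = sets borel" "sets N = sets borel" by (simp_all add: M_def N_def)
    fix x :: real
    consider "x < 0" | "0 \<le> x" "x < 1" | "x \<ge> 1" by linarith
    thus eq: "emeasure M {x<..} = emeasure N {x<..}"
    proof cases
      case 1
      have "x < (norm z)\<^sup>2" for z :: complex using 1 by (smt (verit) zero_le_power2)
      hence "ball (0 :: complex) 1 \<inter> {z. x < (norm z)\<^sup>2} = ball 0 1" by auto
      moreover have "{0<..<1} \<inter> {x<..} = {0<..<1}" using 1 by auto
      ultimately show ?thesis unfolding M N by (simp add: vol)
    next
      case 2
      have key: "(x < (norm z)\<^sup>2) = (sqrt x < norm z)" for z :: complex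
        using 2 by (metis norm_ge_zero real_sqrt_abs abs_norm_cancel real_sqrt_less_iff)
      have "ball (0 :: complex) 1 \<inter> {z. x < (norm z)\<^sup>2} = ball 0 1 - cball 0 (sqrt x)"
        unfolding key by (auto simp: not_le)
      moreover have "emeasure lborel (ball (0 :: complex) 1 - cball 0 (sqrt x)) = ennreal pi - ennreal (pi * x)"
      proof -
        have "sqrt x < 1" using 2 by simp
        hence "cball (0 :: complex) (sqrt x) \<subseteq> ball 0 1" by (subst cball_subset_ball_iff) simp
        thus ?thesis using 2 by (subst emeasure_Diff) (auto simp: vol)
      qed
      moreover have "{0<..<1} \<inter> {x<..} = {x<..<1}" using 2 by auto
      ultimately show ?thesis unfolding M N using 2
        by (simp add: ennreal_minus right_diff_distrib flip: ennreal_mult)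
    next
      case 3
      have "\<not> x < (norm z)\<^sup>2" if "norm z < 1" for z :: complex
        using 3 that power_le_one[of "norm z" 2] by auto
      hence "ball (0 :: complex) 1 \<inter> {z. x < (norm z)\<^sup>2} = {}" by auto
      moreover have "{0<..<1} \<inter> {x<..} = {}" using 3 by auto
      ultimately show ?thesis unfolding M N by simp
    qed
    have "emeasure M {x<..} \<le> emeasure lborel (ball (0 :: complex) 1)"
      unfolding M by (rule emeasure_mono) auto
    thus "emeasure M {x<..} < \<infinity>"
      by (simp add: vol order_le_less_trans)
  qed
  have "(\<integral>\<^sup>+z\<in>ball (0 :: complex) 1. g ((norm z)\<^sup>2) \<partial>lborel) = (\<integral>\<^sup>+t. g t \<partial>M)"
    unfolding M_def by (subst nn_integral_distr, simp, simp, subst nn_integral_density)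
       (auto simp: mult.commute intro!: borel_measurable_indicator)
  also have "\<dots> = ennreal pi * (\<integral>\<^sup>+t\<in>{0<..<1}. g t \<partial>lborel)"
    unfolding \<open>M = N\<close> N_def
    by (subst nn_integral_density) (auto simp: mult.assoc nn_integral_cmult mult.commute[of "indicator _ _"])
  finally show ?thesis .
qed

section \<open>Weighted norms of power series for a real index\<close>

definition monom_norm_sq_real :: "real \<Rightarrow> nat \<Rightarrow> real" where
  "monom_norm_sq_real s n = fact n / pochhammer s n"

lemma nn_integral_beta:
  assumes s: "s > 1"
  shows "(\<integral>\<^sup>+t\<in>{0<..<1}. ennreal ((s - 1) * (1 - t) powr (s - 2) * t ^ n) \<partial>lborel) = ennreal (monom_norm_sq_real s n)"
proof -
  have "((\<lambda>t. t powr (real n + 1 - 1) * (1 - t) powr (s - 1 - 1)) has_integral Beta (real n + 1) (s - 1)) {0..1}"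
    by (rule has_integral_Beta_real) (use s in auto)
  hence "((\<lambda>t. t powr (real n + 1 - 1) * (1 - t) powr (s - 1 - 1)) has_integral Beta (real n + 1) (s - 1)) {0<..<1}"
    by (simp add: has_integral_Icc_iff_Ioo)
  hence "((\<lambda>t. (s - 1) * (t powr (real n + 1 - 1) * (1 - t) powr (s - 1 - 1))) has_integral (s - 1) * Beta (real n + 1) (s - 1)) {0<..<1}"
    by (rule has_integral_mult_right)
  hence "((\<lambda>t. (s - 1) * (1 - t) powr (s - 2) * t ^ n) has_integral (s - 1) * Beta (real n + 1) (s - 1)) {0<..<1}"
    by (rule has_integral_eq[rotated]) (auto simp: powr_realpow)
  moreover have "0 \<le> (s - 1) * (1 - t) powr (s - 2) * t ^ n" if "t \<in> {0<..<1}" for t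
    using that s by simp
  ultimately have "(\<integral>\<^sup>+t. ennreal (indicator {0<..<1} t * ((s - 1) * (1 - t) powr (s - 2) * t ^ n)) \<partial>lborel) =
      ennreal ((s - 1) * Beta (real n + 1) (s - 1))"
    using nn_integral_has_integral_lebesgue[of "{0<..<1}" "\<lambda>t. (s - 1) * (1 - t) powr (s - 2) * t ^ n"]
    by (simp add: nn_integral_completion)
  also have "(s - 1) * Beta (real n + 1) (s - 1) = monom_norm_sq_real s n"
  proof -
    have "s \<notin> \<int>\<^sub>\<le>\<^sub>0" using s by (auto elim!: nonpos_Ints_cases)
    hence "pochhammer s n = Gamma (s + n) / Gamma s" by (rule pochhammer_Gamma)
    \<comment> \<open>The factor s - 1 in front of the integral absorbs the pole of the Beta
      function at s = 1, so the norms have a finite limit there.\<close>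
    moreover have "Gamma s = (s - 1) * Gamma (s - 1)"
      using Gamma_plus1[of "s - 1"] nonpos_Ints_nonpos[of "s - 1"] s by auto
    moreover have "Gamma (real n + 1) = fact n" using Gamma_fact[of n] by (simp add: add.commute)
    ultimately show ?thesis by (simp add: monom_norm_sq_real_def Beta_def add_ac)
  qed
  finally show ?thesis
    by (simp add: indicator_mult_ennreal mult.commute)
qed

text \<open>Averaging over rotations makes Parseval applicable on each circle, which removes the
  mixed terms; the radial integral of each monomial is then a Beta integral. All terms are
  nonnegative, so the identity holds in [0, \<infinity>] and can convert finiteness of the norm into
  summability.\<close>

lemma weighted_norm_sq_series:
  assumes s: "s > 1" and f: "\<And>z. norm z < 1 \<Longrightarrow> (\<lambda>n. a n * z ^ n) sums f z"
  shows "weighted_norm_sq s f = (\<Sum>n. ennreal ((cmod (a n))\<^sup>2 * monom_norm_sq_real s n))"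
proof -
  define W where "W = (\<lambda>t. (s - 1) / pi * (1 - t) powr (s - 2))"
  have W: "W t \<ge> 0" for t using s by (simp add: W_def)
  have [measurable]: "W \<in> borel_measurable borel" by (simp add: W_def)
  have [measurable]: "ball (0 :: complex) 1 \<in> sets borel" by simp
  define F where "F = (\<lambda>z. ennreal (W ((norm z)\<^sup>2) * (cmod (f z))\<^sup>2) * indicator (ball 0 1) z)"
  have contf: "continuous_on (ball 0 1) f"
    by (intro holomorphic_on_imp_continuous_on power_series_holomorphic) (use f in auto)
  \<comment> \<open>Nothing is known about f off the disk, so measurability is obtained for its
    cut-off, in terms of which \<open>F\<close> is rewritten below.\<close>
  have f' [measurable]: "(\<lambda>z. indicator (ball 0 1) z *\<^sub>R f z) \<in> borel_measurable borel"
    by (rule borel_measurable_continuous_on_indicator[OF _ contf]) simp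
  have F_eq: "F = (\<lambda>z. ennreal (W ((norm z)\<^sup>2) * (cmod (indicator (ball 0 1) z *\<^sub>R f z))\<^sup>2))"
    by (auto simp: F_def fun_eq_iff indicator_def)
  have F [measurable]: "F \<in> borel_measurable borel" unfolding F_eq by measurable
  have wF: "weighted_norm_sq s f = (\<integral>\<^sup>+z. F z \<partial>lborel)"
    by (simp add: weighted_norm_sq_def F_def W_def)
  have inner: "(\<integral>\<^sup>+\<theta>\<in>{-pi..pi}. F (cis \<theta> * z) \<partial>lborel) =
      ennreal (2 * pi) * ((\<Sum>n. ennreal ((cmod (a n))\<^sup>2 * (W ((norm z)\<^sup>2) * ((norm z)\<^sup>2) ^ n))) * indicator (ball 0 1) z)" for z
  proof (cases "norm z < 1")
    case True
    define p where "p = (\<lambda>n. a n * z ^ n)"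
    have p: "summable (\<lambda>n. cmod (p n))"
    proof -
      obtain x where x: "norm z < x" "x < 1" using dense[OF True] by auto
      hence x': "norm (of_real x :: complex) < 1" using norm_ge_zero[of z] by (simp del: norm_ge_zero)
      have "norm z < norm (of_real x :: complex)" using x norm_ge_zero[of z] by (simp del: norm_ge_zero)
      thus ?thesis unfolding p_def by (rule powser_insidea[OF sums_summable[OF f[OF x']]])
    qed
    note P = parseval[OF _ p, of 1, simplified]
    have fz: "f (cis \<theta> * z) = (\<Sum>n. p n * cis \<theta> ^ n)" for \<theta>
      using f[of "cis \<theta> * z"] True by (simp add: p_def sums_iff norm_mult power_mult_distrib mult_ac)
    have "(\<integral>\<^sup>+\<theta>\<in>{-pi..pi}. F (cis \<theta> * z) \<partial>lborel) =
        (\<integral>\<^sup>+\<theta>. ennreal (W ((norm z)\<^sup>2)) * ennreal (indicator {-pi..pi} \<theta> *\<^sub>R (cmod (\<Sum>n. p n * cis \<theta> ^ n))\<^sup>2) \<partial>lborel)"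
      using True W by (intro nn_integral_cong)
        (auto simp: F_def fz norm_mult indicator_def ennreal_mult)
    also have "\<dots> = ennreal (W ((norm z)\<^sup>2)) * (\<integral>\<^sup>+\<theta>. ennreal (indicator {-pi..pi} \<theta> *\<^sub>R (cmod (\<Sum>n. p n * cis \<theta> ^ n))\<^sup>2) \<partial>lborel)"
      using P(1) by (intro nn_integral_cmult) (auto simp: set_integrable_def)
    also have "(\<integral>\<^sup>+\<theta>. ennreal (indicator {-pi..pi} \<theta> *\<^sub>R (cmod (\<Sum>n. p n * cis \<theta> ^ n))\<^sup>2) \<partial>lborel) =
       ennreal (LBINT \<theta>:{-pi..pi}. (cmod (\<Sum>n. p n * cis \<theta> ^ n))\<^sup>2)"
      using P(1) unfolding set_integrable_def set_lebesgue_integral_def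
      by (intro nn_integral_eq_integral) auto
    also have "(LBINT \<theta>:{-pi..pi}. (cmod (\<Sum>n. p n * cis \<theta> ^ n))\<^sup>2) = 2 * pi * (\<Sum>n. (cmod (p n))\<^sup>2)"
      using P(2) by (simp add: sums_iff)
    also have "ennreal (W ((norm z)\<^sup>2)) * ennreal (2 * pi * (\<Sum>n. (cmod (p n))\<^sup>2)) =
       ennreal (2 * pi) * (ennreal (W ((norm z)\<^sup>2)) * ennreal (\<Sum>n. (cmod (p n))\<^sup>2))"
    proof -
      have "0 \<le> (\<Sum>n. (cmod (p n))\<^sup>2)"
        using P(2) by (intro suminf_nonneg) (auto simp: sums_iff)
      hence "ennreal (2 * pi * (\<Sum>n. (cmod (p n))\<^sup>2)) = ennreal (2 * pi) * ennreal (\<Sum>n. (cmod (p n))\<^sup>2)"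
        by (intro ennreal_mult) auto
      thus ?thesis by (simp only: mult_ac)
    qed
    also have "ennreal (\<Sum>n. (cmod (p n))\<^sup>2) = (\<Sum>n. ennreal ((cmod (p n))\<^sup>2))"
      using P(2) by (intro suminf_ennreal2[symmetric]) (auto simp: sums_iff)
    also have "ennreal (W ((norm z)\<^sup>2)) * \<dots> = (\<Sum>n. ennreal ((cmod (a n))\<^sup>2 * (W ((norm z)\<^sup>2) * ((norm z)\<^sup>2) ^ n)))"
      unfolding ennreal_suminf_cmult[symmetric] using W
      by (intro arg_cong[where f = suminf] ext)
         (simp add: p_def norm_mult norm_power power_mult_distrib mult_ac power_mult[symmetric] flip: ennreal_mult)
    finally show ?thesis using True by simp
  qed (simp add: F_def norm_mult)
  have term_eq: "(\<integral>\<^sup>+z\<in>ball (0 :: complex) 1. ennreal ((cmod (a n))\<^sup>2 * (W ((norm z)\<^sup>2) * ((norm z)\<^sup>2) ^ n)) \<partial>lborel) =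
      ennreal ((cmod (a n))\<^sup>2 * monom_norm_sq_real s n)" for n
  proof -
    have "(\<integral>\<^sup>+z\<in>ball (0 :: complex) 1. ennreal ((cmod (a n))\<^sup>2 * (W ((norm z)\<^sup>2) * ((norm z)\<^sup>2) ^ n)) \<partial>lborel) =
      ennreal pi * (\<integral>\<^sup>+t\<in>{0<..<1}. ennreal ((cmod (a n))\<^sup>2 * (W t * t ^ n)) \<partial>lborel)"
      by (rule nn_integral_disk_radial) measurable
    also have "(\<integral>\<^sup>+t\<in>{0<..<1}. ennreal ((cmod (a n))\<^sup>2 * (W t * t ^ n)) \<partial>lborel) =
      (\<integral>\<^sup>+t. ennreal ((cmod (a n))\<^sup>2 / pi) * (ennreal ((s - 1) * (1 - t) powr (s - 2) * t ^ n) * indicator {0<..<1} t) \<partial>lborel)"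
      using s by (intro nn_integral_cong) (auto simp: indicator_def W_def simp flip: ennreal_mult)
    also have "\<dots> = ennreal ((cmod (a n))\<^sup>2 / pi) * ennreal (monom_norm_sq_real s n)"
      by (subst nn_integral_cmult) (use nn_integral_beta[OF s, of n] in auto)
    also have "ennreal pi * \<dots> = ennreal ((cmod (a n))\<^sup>2 * monom_norm_sq_real s n)"
      using s by (simp add: monom_norm_sq_real_def pochhammer_nonneg flip: ennreal_mult)
    finally show ?thesis .
  qed
  \<comment> \<open>Rotation invariance of area: the integral of \<open>F\<close> equals that of
    each of its rotations, and hence its mean over \<theta>, where Tonelli brings the circle
    integral inside.\<close>
  have "ennreal (2 * pi) * weighted_norm_sq s f =
      (\<integral>\<^sup>+\<theta>. weighted_norm_sq s f * indicator {-pi..pi} \<theta> \<partial>lborel)"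
    by (simp add: nn_integral_cmult_indicator mult.commute)
  also have "\<dots> = (\<integral>\<^sup>+\<theta>. \<integral>\<^sup>+z. F (cis \<theta> * z) * indicator {-pi..pi} \<theta> \<partial>lborel \<partial>lborel)"
    unfolding wF by (simp add: nn_integral_multc nn_integral_rotate[OF F, of "cis _"])
  also have "\<dots> = (\<integral>\<^sup>+z. \<integral>\<^sup>+\<theta>. F (cis \<theta> * z) * indicator {-pi..pi} \<theta> \<partial>lborel \<partial>lborel)"
    by (rule lborel_pair.Fubini'[symmetric]) (simp add: cis_conv_exp)
  also have "\<dots> = (\<integral>\<^sup>+z. ennreal (2 * pi) * (\<Sum>n. ennreal ((cmod (a n))\<^sup>2 * (W ((cmod z)\<^sup>2) * ((cmod z)\<^sup>2) ^ n)) * indicator (ball 0 1) z) \<partial>lborel)"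
    unfolding inner by (simp flip: ennreal_suminf_multc)
  also have "\<dots> = ennreal (2 * pi) * (\<integral>\<^sup>+z. (\<Sum>n. ennreal ((cmod (a n))\<^sup>2 * (W ((cmod z)\<^sup>2) * ((cmod z)\<^sup>2) ^ n)) * indicator (ball 0 1) z) \<partial>lborel)"
    by (rule nn_integral_cmult) measurable
  also have "(\<integral>\<^sup>+z. (\<Sum>n. ennreal ((cmod (a n))\<^sup>2 * (W ((cmod z)\<^sup>2) * ((cmod z)\<^sup>2) ^ n)) * indicator (ball 0 1) z) \<partial>lborel) =
      (\<Sum>n. \<integral>\<^sup>+z\<in>ball 0 1. ennreal ((cmod (a n))\<^sup>2 * (W ((cmod z)\<^sup>2) * ((cmod z)\<^sup>2) ^ n)) \<partial>lborel)"
    by (rule nn_integral_suminf) measurable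
  also have "\<dots> = (\<Sum>n. ennreal ((cmod (a n))\<^sup>2 * monom_norm_sq_real s n))"
    by (simp only: term_eq)
  finally show ?thesis
    by (simp add: ennreal_mult_cancel_left)
qed

section \<open>The inner product in terms of Taylor coefficients\<close>

lemma monom_norm_sq_real_Suc: "monom_norm_sq_real (real (Suc p)) n = monom_norm_sq p n"
proof -
  have "pochhammer (real p + 1) n / fact n = real ((n + p) choose n)"
    using gbinomial_pochhammer'[of "real (n + p)" n] by (simp add: binomial_gbinomial add.commute)
  also have "(n + p) choose n = (n + p) choose p"
    using binomial_symmetric[of n "n + p"] by simp
  finally have *: "pochhammer (real p + 1) n / fact n = real ((n + p) choose p)" .
  show ?thesis
    unfolding monom_norm_sq_real_def monom_norm_sq_def *[symmetric] by (simp add: add.commute)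
qed

lemma monom_norm_sq_0: "monom_norm_sq 0 n = 1"
  by (simp add: monom_norm_sq_def)

lemma monom_norm_sq_real_nonneg: "s \<ge> 1 \<Longrightarrow> monom_norm_sq_real s n \<ge> 0"
  by (simp add: monom_norm_sq_real_def pochhammer_nonneg)

lemma monom_norm_sq_real_le_1:
  assumes "s \<ge> 1"
  shows "monom_norm_sq_real s n \<le> 1"
proof -
  have "(fact n :: real) \<le> pochhammer s n"
    unfolding pochhammer_fact pochhammer_prod by (intro prod_mono) (use assms in auto)
  thus ?thesis using pochhammer_pos[of s n] assms by (simp add: monom_norm_sq_real_def)
qed

lemma tendsto_monom_norm_sq_real: "((\<lambda>s. monom_norm_sq_real s n) \<longlongrightarrow> 1) (at_right 1)"
proof -
  have "((\<lambda>s. fact n / (\<Prod>i = 0..<n. s + of_nat i)) \<longlongrightarrow> fact n / (\<Prod>i = 0..<n. 1 + of_nat i)) (at_right (1 :: real))"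
    by (intro tendsto_intros) (simp flip: pochhammer_prod pochhammer_fact)
  thus ?thesis
    by (simp add: monom_norm_sq_real_def flip: pochhammer_prod pochhammer_fact)
qed

lemma weighted_norm_integral:
  assumes s: "s > 1" and f: "\<And>z. norm z < 1 \<Longrightarrow> (\<lambda>n. a n * z ^ n) sums f z"
    and summ: "summable (\<lambda>n. (cmod (a n))\<^sup>2 * monom_norm_sq_real s n)"
  shows "has_bochner_integral lborel
     (\<lambda>z. indicator (ball 0 1) z *\<^sub>R ((s - 1) / pi * ((1 - (cmod z)\<^sup>2) powr (s - 2) * (cmod (f z))\<^sup>2)))
     (\<Sum>n. (cmod (a n))\<^sup>2 * monom_norm_sq_real s n)"
proof (rule has_bochner_integral_nn_integral)
  have contf: "continuous_on (ball 0 1) f"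
    by (intro holomorphic_on_imp_continuous_on power_series_holomorphic) (use f in auto)
  have [measurable]: "(\<lambda>z. indicator (ball 0 1) z *\<^sub>R f z) \<in> borel_measurable borel"
    by (rule borel_measurable_continuous_on_indicator[OF _ contf]) simp
  have "(\<lambda>z. (s - 1) / pi * ((1 - (cmod z)\<^sup>2) powr (s - 2) * (cmod (indicator (ball 0 1) z *\<^sub>R f z))\<^sup>2))
     \<in> borel_measurable lborel" by measurable
  also have "(\<lambda>z. (s - 1) / pi * ((1 - (cmod z)\<^sup>2) powr (s - 2) * (cmod (indicator (ball 0 1) z *\<^sub>R f z))\<^sup>2)) =
     (\<lambda>z. indicator (ball 0 1) z *\<^sub>R ((s - 1) / pi * ((1 - (cmod z)\<^sup>2) powr (s - 2) * (cmod (f z))\<^sup>2)))"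
    by (auto simp: indicator_def)
  finally show "(\<lambda>z. indicator (ball 0 1) z *\<^sub>R ((s - 1) / pi * ((1 - (cmod z)\<^sup>2) powr (s - 2) * (cmod (f z))\<^sup>2)))
     \<in> borel_measurable lborel" .
  show "0 \<le> (\<Sum>n. (cmod (a n))\<^sup>2 * monom_norm_sq_real s n)"
    using s by (intro suminf_nonneg summ mult_nonneg_nonneg monom_norm_sq_real_nonneg) auto
  show "AE z in lborel. 0 \<le> indicator (ball 0 1) z *\<^sub>R ((s - 1) / pi * ((1 - (cmod z)\<^sup>2) powr (s - 2) * (cmod (f z))\<^sup>2))"
    using s by (intro AE_I2) simp
  have "(\<integral>\<^sup>+ z. ennreal (indicator (ball 0 1) z *\<^sub>R ((s - 1) / pi * ((1 - (cmod z)\<^sup>2) powr (s - 2) * (cmod (f z))\<^sup>2))) \<partial>lborel)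
     = weighted_norm_sq s f"
    unfolding weighted_norm_sq_def by (intro nn_integral_cong) (auto simp: indicator_def mult.assoc)
  also have "\<dots> = (\<Sum>n. ennreal ((cmod (a n))\<^sup>2 * monom_norm_sq_real s n))"
    by (rule weighted_norm_sq_series[OF s f])
  also have "\<dots> = ennreal (\<Sum>n. (cmod (a n))\<^sup>2 * monom_norm_sq_real s n)"
    using s by (intro suminf_ennreal2 summ mult_nonneg_nonneg monom_norm_sq_real_nonneg) auto
  finally show "(\<integral>\<^sup>+ z. ennreal (indicator (ball 0 1) z *\<^sub>R ((s - 1) / pi * ((1 - (cmod z)\<^sup>2) powr (s - 2) * (cmod (f z))\<^sup>2))) \<partial>lborel)
     = ennreal (\<Sum>n. (cmod (a n))\<^sup>2 * monom_norm_sq_real s n)" .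
qed

lemma polarization:
  fixes x y :: complex
  shows "cnj x * y = (of_real ((cmod (x + y))\<^sup>2) - of_real ((cmod (x - y))\<^sup>2)
     - \<i> * (of_real ((cmod (x + \<i> * y))\<^sup>2) - of_real ((cmod (x - \<i> * y))\<^sup>2))) / 4"
  unfolding complex_norm_square by (simp add: algebra_simps)

text \<open>Polarization, applied once to the coefficients and once to the integrand, reduces the
  inner product to the norms of f + c g with c = 1, -1, i, -i. Integrability of the mixed product
  comes with it.\<close>

lemma weighted_inner_series:
  assumes s: "s > 1" and f: "\<And>z. norm z < 1 \<Longrightarrow> (\<lambda>n. a n * z ^ n) sums f z"
    and g: "\<And>z. norm z < 1 \<Longrightarrow> (\<lambda>n. b n * z ^ n) sums g z"
    and a: "summable (\<lambda>n. (cmod (a n))\<^sup>2 * monom_norm_sq_real s n)"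
    and b: "summable (\<lambda>n. (cmod (b n))\<^sup>2 * monom_norm_sq_real s n)"
  shows "(\<lambda>n. cnj (a n) * b n * of_real (monom_norm_sq_real s n)) sums weighted_inner s f g"
proof -
  define h where "h = monom_norm_sq_real s"
  define w where "w = (\<lambda>z::complex. (s - 1) / pi * (indicator (ball 0 1) z * (1 - (cmod z)\<^sup>2) powr (s - 2)))"
  define I where "I = (\<lambda>c. \<Sum>n. (cmod (a n + c * b n))\<^sup>2 * h n)"
  have h: "h n \<ge> 0" for n using s by (simp add: h_def monom_norm_sq_real_nonneg)
  have summ: "summable (\<lambda>n. (cmod (a n + c * b n))\<^sup>2 * h n)" if c: "norm c = 1" for c
  proof (rule summable_comparison_test'[where N = 0])
    show "summable (\<lambda>n. 2 * ((cmod (a n))\<^sup>2 * h n + (cmod (b n))\<^sup>2 * h n))"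
      using a b unfolding h_def by (intro summable_mult summable_add)
    fix n
    have "(cmod (a n + c * b n))\<^sup>2 \<le> (cmod (a n) + cmod (b n))\<^sup>2"
      using norm_triangle_ineq[of "a n" "c * b n"] c by (intro power_mono) (auto simp: norm_mult)
    also have "\<dots> \<le> 2 * ((cmod (a n))\<^sup>2 + (cmod (b n))\<^sup>2)"
      using sum_squares_bound[of "cmod (a n)" "cmod (b n)"] by (simp add: power2_sum)
    finally have "(cmod (a n + c * b n))\<^sup>2 * h n \<le> 2 * ((cmod (a n))\<^sup>2 + (cmod (b n))\<^sup>2) * h n"
      by (intro mult_right_mono h)
    thus "norm ((cmod (a n + c * b n))\<^sup>2 * h n) \<le> 2 * ((cmod (a n))\<^sup>2 * h n + (cmod (b n))\<^sup>2 * h n)"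
      using h[of n] by (simp add: algebra_simps)
  qed
  have sums: "(\<lambda>n. complex_of_real ((cmod (a n + c * b n))\<^sup>2 * h n)) sums of_real (I c)" if "norm c = 1" for c
    unfolding sums_of_real_iff I_def by (rule summable_sums[OF summ[OF that]])
  have int: "has_bochner_integral lborel (\<lambda>z. complex_of_real (w z * (cmod (f z + c * g z))\<^sup>2)) (of_real (I c))"
    if c: "norm c = 1" for c
  proof -
    have "(\<lambda>n. (a n + c * b n) * z ^ n) sums (f z + c * g z)" if "norm z < 1" for z
      using sums_add[OF f[OF that] sums_mult[OF g[OF that], of c]] by (simp add: algebra_simps)
    from weighted_norm_integral[OF s this summ[OF c, unfolded h_def]]
    have "has_bochner_integral lborel (\<lambda>z. w z * (cmod (f z + c * g z))\<^sup>2) (I c)"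
      by (simp add: w_def I_def h_def mult_ac)
    thus ?thesis by (rule has_bochner_integral_of_real)
  qed
  define J where "J = (of_real (I 1) - of_real (I (-1)) - \<i> * (of_real (I \<i>) - of_real (I (-\<i>)))) / 4"
  have "(\<lambda>n. (of_real ((cmod (a n + 1 * b n))\<^sup>2 * h n) - of_real ((cmod (a n + (-1) * b n))\<^sup>2 * h n) -
      \<i> * (of_real ((cmod (a n + \<i> * b n))\<^sup>2 * h n) - of_real ((cmod (a n + (-\<i>) * b n))\<^sup>2 * h n))) / 4) sums J"
    unfolding J_def by (intro sums_divide sums_diff sums_mult sums) auto
  also have "(\<lambda>n. (of_real ((cmod (a n + 1 * b n))\<^sup>2 * h n) - of_real ((cmod (a n + (-1) * b n))\<^sup>2 * h n) -
      \<i> * (of_real ((cmod (a n + \<i> * b n))\<^sup>2 * h n) - of_real ((cmod (a n + (-\<i>) * b n))\<^sup>2 * h n))) / 4) =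
      (\<lambda>n. cnj (a n) * b n * of_real (h n))"
    unfolding polarization by (auto simp: algebra_simps)
  finally have "(\<lambda>n. cnj (a n) * b n * of_real (h n)) sums J" .
  moreover have "weighted_inner s f g = J"
  proof -
    have "has_bochner_integral lborel (\<lambda>z. (of_real (w z * (cmod (f z + 1 * g z))\<^sup>2) - of_real (w z * (cmod (f z + (-1) * g z))\<^sup>2) -
      \<i> * (of_real (w z * (cmod (f z + \<i> * g z))\<^sup>2) - of_real (w z * (cmod (f z + (-\<i>) * g z))\<^sup>2))) / 4) J"
      unfolding J_def
      by (intro has_bochner_integral_divide has_bochner_integral_diff has_bochner_integral_mult_right int) auto
    also have "(\<lambda>z. (of_real (w z * (cmod (f z + 1 * g z))\<^sup>2) - of_real (w z * (cmod (f z + (-1) * g z))\<^sup>2) -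
      \<i> * (of_real (w z * (cmod (f z + \<i> * g z))\<^sup>2) - of_real (w z * (cmod (f z + (-\<i>) * g z))\<^sup>2))) / 4) =
      (\<lambda>z. of_real (w z) * (cnj (f z) * g z))"
      unfolding polarization by (auto simp: algebra_simps)
    also have "\<dots> = (\<lambda>z. of_real ((s - 1) / pi) * (indicator (ball 0 1) z *\<^sub>R
        (complex_of_real ((1 - (cmod z)\<^sup>2) powr (s - 2)) * (cnj (f z) * g z))))"
      by (simp add: w_def scaleR_conv_of_real mult_ac)
    finally have "(LBINT z. of_real ((s - 1) / pi) * (indicator (ball 0 1) z *\<^sub>R
        (complex_of_real ((1 - (cmod z)\<^sup>2) powr (s - 2)) * (cnj (f z) * g z)))) = J"
      by (rule has_bochner_integral_integral_eq)
    thus ?thesis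
      unfolding weighted_inner_def set_lebesgue_integral_def by (simp only: integral_mult_right_zero)
  qed
  ultimately show ?thesis by (simp add: h_def)
qed

text \<open>For p = 0 the limit s \<rightarrow> 1 passes through the series by Tannery's theorem:
  the weights tend to 1 and are at most 1, so \<open>|a_n|^2 + |b_n|^2\<close> dominates. The limit
  thus exists, and \<open>Lim\<close> returns it.\<close>

lemma H_inner_series:
  assumes f: "\<And>z. norm z < 1 \<Longrightarrow> (\<lambda>n. a n * z ^ n) sums f z"
    and g: "\<And>z. norm z < 1 \<Longrightarrow> (\<lambda>n. b n * z ^ n) sums g z"
    and a: "summable (\<lambda>n. (cmod (a n))\<^sup>2 * monom_norm_sq p n)"
    and b: "summable (\<lambda>n. (cmod (b n))\<^sup>2 * monom_norm_sq p n)"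
  shows "H_inner (Suc p) f g = (\<Sum>n. cnj (a n) * b n * of_real (monom_norm_sq p n))"
proof (cases "p = 0")
  case False
  hence s: "real (Suc p) > 1" by simp
  note a' = a[folded monom_norm_sq_real_Suc] and b' = b[folded monom_norm_sq_real_Suc]
  have "H_inner (Suc p) f g = weighted_inner (real (Suc p)) f g"
    using False by (simp add: H_inner_def)
  thus ?thesis
    using sums_unique[OF weighted_inner_series[OF s f g a' b']]
    unfolding monom_norm_sq_real_Suc by simp
next
  case True
  have a1: "summable (\<lambda>n. (cmod (a n))\<^sup>2)" and b1: "summable (\<lambda>n. (cmod (b n))\<^sup>2)"
    using a b by (simp_all add: True monom_norm_sq_0)
  have h: "0 \<le> monom_norm_sq_real s n" "monom_norm_sq_real s n \<le> 1" if "s > 1" for s n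
    using that by (simp_all add: monom_norm_sq_real_nonneg monom_norm_sq_real_le_1)
  have summ: "summable (\<lambda>n. (cmod (x n))\<^sup>2 * monom_norm_sq_real s n)"
    if "summable (\<lambda>n. (cmod (x n))\<^sup>2)" "s > 1" for x s
    by (rule summable_comparison_test'[OF that(1), of 0]) (use h[OF that(2)] in \<open>auto simp: mult_left_le\<close>)
  define t where "t = (\<lambda>n s. cnj (a n) * b n * of_real (monom_norm_sq_real s n))"
  have gt: "eventually (\<lambda>s. s > (1 :: real)) (at_right 1)"
    by (rule eventually_at_right_less)
  have "((\<lambda>s. \<Sum>n. t n s) \<longlongrightarrow> (\<Sum>n. cnj (a n) * b n)) (at_right 1)"
  proof (rule tannerys_theorem[THEN conjunct2, THEN conjunct2])
    show "((\<lambda>s. t n s) \<longlongrightarrow> cnj (a n) * b n) (at_right 1)" for n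
      using tendsto_mult[OF tendsto_const[of "cnj (a n) * b n"] tendsto_of_real[OF tendsto_monom_norm_sq_real[of n]]]
      by (simp add: t_def)
    show "summable (\<lambda>n. (cmod (a n))\<^sup>2 + (cmod (b n))\<^sup>2)"
      by (intro summable_add a1 b1)
    have *: "norm (t n s) \<le> (cmod (a n))\<^sup>2 + (cmod (b n))\<^sup>2" if "s > 1" for n s
    proof -
      have "norm (t n s) = (cmod (a n) * cmod (b n)) * monom_norm_sq_real s n"
        using h[OF that, of n] by (simp add: t_def norm_mult)
      also have "\<dots> \<le> cmod (a n) * cmod (b n)"
        using h[OF that, of n] by (intro mult_left_le) auto
      also have "\<dots> \<le> (cmod (a n))\<^sup>2 + (cmod (b n))\<^sup>2"
        using sum_squares_bound[of "cmod (a n)" "cmod (b n)"]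
          mult_nonneg_nonneg[OF norm_ge_zero[of "a n"] norm_ge_zero[of "b n"]] by linarith
      finally show ?thesis .
    qed
    show "eventually (\<lambda>(n, s). norm (t n s) \<le> (cmod (a n))\<^sup>2 + (cmod (b n))\<^sup>2) (at_top \<times>\<^sub>F at_right 1)"
      by (rule eventually_mono[OF eventually_prodI[OF eventually_True gt]]) (use * in auto)
  qed simp
  moreover have "eventually (\<lambda>s. (\<Sum>n. t n s) = weighted_inner s f g) (at_right 1)"
    using gt
  proof eventually_elim
    case (elim s)
    show ?case
      using sums_unique[OF weighted_inner_series[OF elim f g summ[OF a1 elim] summ[OF b1 elim]]]
      by (simp add: t_def)
  qed
  ultimately have "((\<lambda>s. weighted_inner s f g) \<longlongrightarrow> (\<Sum>n. cnj (a n) * b n)) (at_right 1)"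
    by (rule Lim_transform_eventually)
  hence "Lim (at_right 1) (\<lambda>s. weighted_inner s f g) = (\<Sum>n. cnj (a n) * b n)"
    by (intro tendsto_Lim) simp_all
  thus ?thesis by (simp add: True H_inner_def monom_norm_sq_0)
qed

lemma H_norm_series:
  assumes f: "\<And>z. norm z < 1 \<Longrightarrow> (\<lambda>n. a n * z ^ n) sums f z"
    and a: "summable (\<lambda>n. (cmod (a n))\<^sup>2 * monom_norm_sq p n)"
  shows "H_norm (Suc p) f = sqrt (\<Sum>n. (cmod (a n))\<^sup>2 * monom_norm_sq p n)"
proof -
  have "cnj (a n) * a n * of_real (monom_norm_sq p n) = of_real ((cmod (a n))\<^sup>2 * monom_norm_sq p n)" for n
    unfolding of_real_mult complex_norm_square by (simp add: mult_ac)
  moreover have "H_inner (Suc p) f f = (\<Sum>n. cnj (a n) * a n * of_real (monom_norm_sq p n))"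
    by (rule H_inner_series[OF f f a a])
  ultimately have "H_inner (Suc p) f f = of_real (\<Sum>n. (cmod (a n))\<^sup>2 * monom_norm_sq p n)"
    by (simp only: suminf_of_real[OF a])
  thus ?thesis by (simp add: H_norm_def)
qed

lemma H_space_series:
  assumes "f \<in> H_space (Suc p)"
  obtains a where "\<And>z. norm z < 1 \<Longrightarrow> (\<lambda>n. a n * z ^ n) sums f z"
    and "summable (\<lambda>n. (cmod (a n))\<^sup>2 * monom_norm_sq p n)"
proof -
  have hol: "f holomorphic_on ball 0 1" and fin: "H_finite_norm (Suc p) f"
    using assms by (auto simp: H_space_def)
  define a where "a = (\<lambda>n. (deriv ^^ n) f 0 / fact n)"
  have f: "(\<lambda>n. a n * z ^ n) sums f z" if "norm z < 1" for z
    using holomorphic_power_series[OF hol, of z] that by (simp add: a_def)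
  moreover have "summable (\<lambda>n. (cmod (a n))\<^sup>2 * monom_norm_sq p n)"
  proof (cases "p = 0")
    case False
    hence s: "real (Suc p) > 1" by simp
    have "weighted_norm_sq (real (Suc p)) f = (\<Sum>n. ennreal ((cmod (a n))\<^sup>2 * monom_norm_sq_real (real (Suc p)) n))"
      by (rule weighted_norm_sq_series[OF s f])
    moreover have "weighted_norm_sq (real (Suc p)) f < top"
      using fin False by (simp add: H_finite_norm_def)
    ultimately have "(\<Sum>n. ennreal ((cmod (a n))\<^sup>2 * monom_norm_sq p n)) \<noteq> top"
      unfolding monom_norm_sq_real_Suc by (metis order_less_irrefl)
    thus ?thesis
      by (rule summable_suminf_not_top[rotated]) (rule mult_nonneg_nonneg, simp_all)
  next
    case True
    then obtain c :: real where c: "((\<lambda>s. weighted_norm_sq s f) \<longlongrightarrow> ennreal c) (at_right 1)"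
      using fin by (auto simp: H_finite_norm_def)
    \<comment> \<open>A Fatou argument: each finite partial sum passes to the limit s \<rightarrow>
      1 below the norms. The maximum with 0 is taken because \<open>ennreal c\<close> is 0 for
      negative c.\<close>
    have "(\<Sum>n<K. (cmod (a n))\<^sup>2) \<le> max 0 c" for K
    proof -
      have "((\<lambda>s. ennreal (\<Sum>n<K. (cmod (a n))\<^sup>2 * monom_norm_sq_real s n)) \<longlongrightarrow>
          ennreal (\<Sum>n<K. (cmod (a n))\<^sup>2 * 1)) (at_right 1)"
        by (intro tendsto_ennrealI tendsto_intros tendsto_monom_norm_sq_real)
      moreover have "eventually (\<lambda>s. ennreal (\<Sum>n<K. (cmod (a n))\<^sup>2 * monom_norm_sq_real s n) \<le> weighted_norm_sq s f) (at_right 1)"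
        using eventually_at_right_less[of "1 :: real"]
      proof eventually_elim
        case (elim s)
        have "ennreal (\<Sum>n<K. (cmod (a n))\<^sup>2 * monom_norm_sq_real s n) =
            (\<Sum>n<K. ennreal ((cmod (a n))\<^sup>2 * monom_norm_sq_real s n))"
          using elim by (intro sum_ennreal[symmetric] mult_nonneg_nonneg monom_norm_sq_real_nonneg) auto
        also have "\<dots> \<le> (\<Sum>n. ennreal ((cmod (a n))\<^sup>2 * monom_norm_sq_real s n))"
          by (intro sum_le_suminf) auto
        also have "\<dots> = weighted_norm_sq s f"
          by (rule weighted_norm_sq_series[OF elim f, symmetric])
        finally show ?case .
      qed
      ultimately have "ennreal (\<Sum>n<K. (cmod (a n))\<^sup>2 * 1) \<le> ennreal c"
        by (intro tendsto_le[OF _ c]) auto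
      also have "\<dots> \<le> ennreal (max 0 c)" by (intro ennreal_leI) simp
      finally show ?thesis by (subst (asm) ennreal_le_iff) auto
    qed
    hence "summable (\<lambda>n. (cmod (a n))\<^sup>2)"
      by (intro summableI_nonneg_bounded[where x = "max 0 c"]) auto
    thus ?thesis by (simp add: True monom_norm_sq_0)
  qed
  ultimately show ?thesis by (rule that)
qed

section \<open>Matrix coefficients of the discrete series\<close>

lemma su11_matrix_nth [simp]:
  "su11_matrix \<alpha> \<beta> $ 1 $ 1 = \<alpha>" "su11_matrix \<alpha> \<beta> $ 1 $ 2 = \<beta>"
  "su11_matrix \<alpha> \<beta> $ 2 $ 1 = cnj \<beta>" "su11_matrix \<alpha> \<beta> $ 2 $ 2 = cnj \<alpha>"
  by (simp_all add: su11_matrix_def)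

lemma matrix_inv_su11:
  assumes "(cmod \<alpha>)\<^sup>2 - (cmod \<beta>)\<^sup>2 = 1"
  shows "matrix_inv (su11_matrix \<alpha> \<beta>) = su11_matrix (cnj \<alpha>) (- \<beta>)"
proof -
  have *: "\<alpha> * cnj \<alpha> - \<beta> * cnj \<beta> = 1"
    using arg_cong[OF assms, of complex_of_real] by (simp add: complex_norm_square flip: of_real_power)
  have **: "su11_matrix \<alpha> \<beta> ** su11_matrix (cnj \<alpha>) (- \<beta>) = mat 1"
    "su11_matrix (cnj \<alpha>) (- \<beta>) ** su11_matrix \<alpha> \<beta> = mat 1"
    using * by (simp_all add: vec_eq_iff forall_2 matrix_matrix_mult_def sum_2 mat_def algebra_simps)
  \<comment> \<open>\<open>matrix_inv\<close> is a choice operator, so a two-sided inverse must be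
    exhibited first; uniqueness of inverses then identifies the chosen one.\<close>
  hence "\<exists>Y. su11_matrix \<alpha> \<beta> ** Y = mat 1 \<and> Y ** su11_matrix \<alpha> \<beta> = mat 1" by blast
  hence "su11_matrix \<alpha> \<beta> ** matrix_inv (su11_matrix \<alpha> \<beta>) = mat 1"
    unfolding matrix_inv_def by (rule someI2_ex) blast
  thus ?thesis using **(2) by (metis matrix_mul_assoc matrix_mul_lid matrix_mul_rid)
qed

lemma kak_eq:
  "k_tilde \<theta>\<^sub>1 ** a_tilde r ** k_tilde \<theta>\<^sub>2 =
     su11_matrix (of_real (cosh r) * cis (- \<theta>\<^sub>1) * cis (- \<theta>\<^sub>2)) (of_real (sinh r) * cis (- \<theta>\<^sub>1) * cis \<theta>\<^sub>2)"
proof -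
  have "exp (- (\<i> * complex_of_real t)) = cis (- t)" "exp (\<i> * complex_of_real t) = cis t" for t
    by (simp_all add: cis_conv_exp)
  thus ?thesis
    by (simp add: vec_eq_iff forall_2 matrix_matrix_mult_def sum_2 k_tilde_def a_tilde_def cis_cnj)
qed

text \<open>The two series are interchanged by complex conjugation of the matrix entries, which negates
  both angles.\<close>

fun series_sgn :: "series_sign \<Rightarrow> int" where
  "series_sgn Plus = 1"
| "series_sgn Minus = -1"

text \<open>Each rotation turns the argument by twice its angle, whence \<open>A^2\<close> and
  \<open>B^2\<close>, and contributes a unimodular factor; all dependence on r sits in the
  transformation of \<open>ds_coeff_transform_sums\<close>.\<close>

lemma discrete_series_kak:
  fixes \<epsilon> :: series_sign and \<theta>\<^sub>1 \<theta>\<^sub>2 r :: real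
  defines "A \<equiv> cis (- (of_int (series_sgn \<epsilon>) * \<theta>\<^sub>1))" and "B \<equiv> cis (- (of_int (series_sgn \<epsilon>) * \<theta>\<^sub>2))"
  assumes z: "norm z < 1"
  shows "discrete_series \<epsilon> l (k_tilde \<theta>\<^sub>1 ** a_tilde r ** k_tilde \<theta>\<^sub>2) g z =
    (A * B) ^ l * (g (B\<^sup>2 * ((of_real (cosh r) * (A\<^sup>2 * z) - of_real (sinh r)) / (of_real (cosh r) - of_real (sinh r) * (A\<^sup>2 * z)))) /
      (of_real (cosh r) - of_real (sinh r) * (A\<^sup>2 * z)) ^ l)"
proof -
  define c s where "c = complex_of_real (cosh r)" and "s = complex_of_real (sinh r)"
  define \<alpha> \<beta> where "\<alpha> = c * A * B" and "\<beta> = s * A * cnj B"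
  define D where "D = c - s * (A\<^sup>2 * z)"
  have A: "A * cnj A = 1" and B: "B * cnj B = 1" and nA: "norm A = 1" and nB: "norm B = 1"
    by (simp_all add: A_def B_def cis_cnj cis_mult)
  have nz: "A \<noteq> 0" "B \<noteq> 0" using nA nB by auto
  have cnj: "cnj A = 1 / A" "cnj B = 1 / B"
    using A B nz by (simp_all add: field_simps)
  have cs: "c\<^sup>2 - s\<^sup>2 = 1" "cnj c = c" "cnj s = s"
    using cosh_square_eq[of r] by (simp_all add: c_def s_def flip: of_real_power of_real_diff)
  have "norm (A\<^sup>2 * z) < 1" using z nA by (simp add: norm_mult norm_power)
  hence D: "D \<noteq> 0"
    unfolding D_def c_def s_def by (intro cosh_minus_nonzero boost_in_disk)
  have den: "cnj \<alpha> - \<beta> * z = D / (A * B)"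
    using nz unfolding \<alpha>_def \<beta>_def D_def by (simp add: cs cnj field_simps power2_eq_square)
  have num: "\<alpha> * z - cnj \<beta> = B * (c * (A\<^sup>2 * z) - s) / A"
    using nz unfolding \<alpha>_def \<beta>_def by (simp add: cs cnj field_simps power2_eq_square)
  define w where "w = (\<alpha> * z - cnj \<beta>) / (cnj \<alpha> - \<beta> * z)"
  have w: "w = B\<^sup>2 * ((c * (A\<^sup>2 * z) - s) / D)"
    using nz D unfolding w_def den num by (simp add: field_simps power2_eq_square)
  have "\<alpha> * cnj \<alpha> - \<beta> * cnj \<beta> = c\<^sup>2 * (A * cnj A) * (B * cnj B) - s\<^sup>2 * (A * cnj A) * (B * cnj B)"
    unfolding \<alpha>_def \<beta>_def by (simp add: cs power2_eq_square)
  hence det: "\<alpha> * cnj \<alpha> - \<beta> * cnj \<beta> = 1" by (simp add: A B cs)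
  hence "complex_of_real ((cmod \<alpha>)\<^sup>2 - (cmod \<beta>)\<^sup>2) = of_real 1"
    unfolding of_real_diff complex_norm_square by simp
  hence det': "(cmod \<alpha>)\<^sup>2 - (cmod \<beta>)\<^sup>2 = 1"
    by (simp only: of_real_eq_iff)
  have den_nz: "cnj \<alpha> - \<beta> * z \<noteq> 0" using den D nz by simp
  \<comment> \<open>The cocycle relation: the multiplier of x at the preimage w of z is the
    reciprocal of that of the inverse of x at z, because the determinant is 1.\<close>
  have "(\<beta> * w + \<alpha>) * (cnj \<alpha> - \<beta> * z) = \<alpha> * cnj \<alpha> - \<beta> * cnj \<beta>"
    unfolding w_def distrib_right using den_nz by (simp add: field_simps)
  hence "\<beta> * w + \<alpha> = 1 / (cnj \<alpha> - \<beta> * z)"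
    using det den_nz by (simp add: field_simps)
  hence mult: "\<beta> * w + \<alpha> = A * B / D" by (simp add: den)
  have "discrete_series \<epsilon> l (k_tilde \<theta>\<^sub>1 ** a_tilde r ** k_tilde \<theta>\<^sub>2) g z = (\<beta> * w + \<alpha>) ^ l * g w"
  proof (cases \<epsilon>)
    case Plus
    have x: "k_tilde \<theta>\<^sub>1 ** a_tilde r ** k_tilde \<theta>\<^sub>2 = su11_matrix \<alpha> \<beta>"
      by (simp add: kak_eq \<alpha>_def \<beta>_def c_def s_def A_def B_def Plus cis_cnj)
    show ?thesis
      unfolding x discrete_series_def matrix_inv_su11[OF det'] Plus
      by (simp add: w_def)
  next
    case Minus
    \<comment> \<open>The angles enter \<open>A\<close> and \<open>B\<close> with the opposite sign
      here, which conjugates the entries; the formulas for \<open>Minus\<close> conjugate them once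
      more, so the same expression results.\<close>
    have x: "k_tilde \<theta>\<^sub>1 ** a_tilde r ** k_tilde \<theta>\<^sub>2 = su11_matrix (cnj \<alpha>) (cnj \<beta>)"
      by (simp add: kak_eq \<alpha>_def \<beta>_def c_def s_def A_def B_def Minus cis_cnj)
    have det'': "(cmod (cnj \<alpha>))\<^sup>2 - (cmod (cnj \<beta>))\<^sup>2 = 1" using det' by simp
    show ?thesis
      unfolding x discrete_series_def matrix_inv_su11[OF det''] Minus
      by (simp add: w_def)
  qed
  also have "\<dots> = (A * B / D) ^ l * g w"
    by (simp only: mult)
  finally show ?thesis
    by (simp add: w D_def c_def s_def power_divide)
qed

text \<open>The second angle twists the coefficients going into the matrix, the first those coming
  out. This separation permits Parseval in one angle at a time.\<close>

lemma discrete_series_kak_series: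
  fixes \<epsilon> :: series_sign and \<theta>\<^sub>1 \<theta>\<^sub>2 r :: real and b :: "nat \<Rightarrow> complex"
  defines "A \<equiv> cis (- (of_int (series_sgn \<epsilon>) * \<theta>\<^sub>1))" and "B \<equiv> cis (- (of_int (series_sgn \<epsilon>) * \<theta>\<^sub>2))"
  assumes g: "\<And>z. norm z < 1 \<Longrightarrow> (\<lambda>n. b n * z ^ n) sums g z"
    and b: "summable (\<lambda>n. (cmod (b n))\<^sup>2 * monom_norm_sq p n)"
    and z: "norm z < 1"
  shows "(\<lambda>n. (A * B) ^ Suc p * ((\<Sum>m. of_real (ds_coeff p r n m) * (b m * (B\<^sup>2) ^ m)) * (A\<^sup>2) ^ n) * z ^ n) sums
    discrete_series \<epsilon> (Suc p) (k_tilde \<theta>\<^sub>1 ** a_tilde r ** k_tilde \<theta>\<^sub>2) g z"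
proof -
  have nA: "norm A = 1" and nB: "norm B = 1" by (simp_all add: A_def B_def)
  define b' where "b' = (\<lambda>m. b m * (B\<^sup>2) ^ m)"
  have nb: "norm (b' m) = norm (b m)" for m by (simp add: b'_def norm_mult norm_power nB)
  have b': "summable (\<lambda>n. (cmod (b' n))\<^sup>2 * monom_norm_sq p n)" using b by (simp add: nb)
  have u: "norm (A\<^sup>2 * z) < 1" using z by (simp add: norm_mult norm_power nA)
  have G: "(\<lambda>m. b' m * w ^ m) sums g (B\<^sup>2 * w)" if "norm w < 1" for w
    using g[of "B\<^sup>2 * w"] that by (simp add: b'_def norm_mult norm_power nB power_mult_distrib mult_ac)
  from sums_mult[OF ds_coeff_transform_sums[OF G summable_ds_coeff_mult[OF b'] suminf_ds_coeff_mult_le[OF b'] u, of r],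
      of "(A * B) ^ Suc p"]
  have "(\<lambda>n. (A * B) ^ Suc p * ((\<Sum>m. of_real (ds_coeff p r n m) * b' m) * (A\<^sup>2 * z) ^ n)) sums
    discrete_series \<epsilon> (Suc p) (k_tilde \<theta>\<^sub>1 ** a_tilde r ** k_tilde \<theta>\<^sub>2) g z"
    unfolding discrete_series_kak[OF z] A_def B_def .
  thus ?thesis by (simp only: b'_def power_mult_distrib mult.assoc)
qed

lemma summable_weighted_product:
  fixes a c :: "nat \<Rightarrow> complex"
  assumes a: "summable (\<lambda>n. (cmod (a n))\<^sup>2 * monom_norm_sq p n)"
    and c: "summable (\<lambda>n. (cmod (c n))\<^sup>2 * monom_norm_sq p n)"
  shows "summable (\<lambda>n. cmod (cnj (a n) * of_real (monom_norm_sq p n) * c n))"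
proof (rule summable_comparison_test'[OF summable_add[OF a c], of 0])
  fix n
  have "cmod (a n) * cmod (c n) \<le> (cmod (a n))\<^sup>2 + (cmod (c n))\<^sup>2"
    using sum_squares_bound[of "cmod (a n)" "cmod (c n)"]
      mult_nonneg_nonneg[OF norm_ge_zero[of "a n"] norm_ge_zero[of "c n"]] by linarith
  hence "cmod (a n) * cmod (c n) * monom_norm_sq p n \<le> ((cmod (a n))\<^sup>2 + (cmod (c n))\<^sup>2) * monom_norm_sq p n"
    by (rule mult_right_mono) simp
  thus "norm (cmod (cnj (a n) * of_real (monom_norm_sq p n) * c n)) \<le>
      (cmod (a n))\<^sup>2 * monom_norm_sq p n + (cmod (c n))\<^sup>2 * monom_norm_sq p n"
    by (simp add: norm_mult algebra_simps)
qed

text \<open>Up to unimodular factors, \<open>G n\<close> is the n-th Taylor coefficient of the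
  transformed function, and it depends on the second angle only. Taking the modulus removes the
  common factor \<open>(A * B)^(p + 1)\<close>.\<close>

lemma kak_coefficient:
  fixes \<epsilon> :: series_sign and \<theta>\<^sub>1 \<theta>\<^sub>2 r :: real and p :: nat and a b :: "nat \<Rightarrow> complex"
  defines "j \<equiv> - 2 * series_sgn \<epsilon>"
  defines "G \<equiv> \<lambda>n \<theta>. \<Sum>m. of_real (ds_coeff p r n m) * b m * cis (of_int j * \<theta>) ^ m"
  assumes f: "\<And>z. norm z < 1 \<Longrightarrow> (\<lambda>n. a n * z ^ n) sums f z"
    and a: "summable (\<lambda>n. (cmod (a n))\<^sup>2 * monom_norm_sq p n)"
    and g: "\<And>z. norm z < 1 \<Longrightarrow> (\<lambda>n. b n * z ^ n) sums g z"
    and b: "summable (\<lambda>n. (cmod (b n))\<^sup>2 * monom_norm_sq p n)"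
  shows "summable (\<lambda>n. (cmod (G n \<theta>\<^sub>2))\<^sup>2 * monom_norm_sq p n)"
    and "(\<Sum>n. (cmod (G n \<theta>\<^sub>2))\<^sup>2 * monom_norm_sq p n) \<le> (\<Sum>n. (cmod (b n))\<^sup>2 * monom_norm_sq p n)"
    and "cmod (H_inner (Suc p) f (discrete_series \<epsilon> (Suc p) (k_tilde \<theta>\<^sub>1 ** a_tilde r ** k_tilde \<theta>\<^sub>2) g)) =
      cmod (\<Sum>n. (cnj (a n) * of_real (monom_norm_sq p n) * G n \<theta>\<^sub>2) * cis (of_int j * \<theta>\<^sub>1) ^ n)"
proof -
  define A where "A = cis (- (of_int (series_sgn \<epsilon>) * \<theta>\<^sub>1))"
  define B where "B = cis (- (of_int (series_sgn \<epsilon>) * \<theta>\<^sub>2))"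
  have A2: "A\<^sup>2 = cis (of_int j * \<theta>\<^sub>1)" and B2: "B\<^sup>2 = cis (of_int j * \<theta>\<^sub>2)"
    by (simp_all add: A_def B_def j_def power2_eq_square cis_mult mult_ac)
  have nA: "norm A = 1" and nB: "norm B = 1" by (simp_all add: A_def B_def)
  define b' where "b' = (\<lambda>m. b m * (B\<^sup>2) ^ m)"
  have nb: "norm (b' m) = norm (b m)" for m by (simp add: b'_def norm_mult norm_power nB)
  have b': "summable (\<lambda>n. (cmod (b' n))\<^sup>2 * monom_norm_sq p n)" using b by (simp add: nb)
  have G_eq: "G n \<theta>\<^sub>2 = (\<Sum>m. of_real (ds_coeff p r n m) * b' m)" for n
    by (simp add: G_def b'_def B2 mult.assoc)
  have bessel: "(\<Sum>n<K. (cmod (G n \<theta>\<^sub>2))\<^sup>2 * monom_norm_sq p n) \<le> (\<Sum>n. (cmod (b n))\<^sup>2 * monom_norm_sq p n)" for K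
    using ds_coeff_bessel[OF b', of r K] by (simp add: G_eq nb)
  show summG: "summable (\<lambda>n. (cmod (G n \<theta>\<^sub>2))\<^sup>2 * monom_norm_sq p n)"
    by (rule summableI_nonneg_bounded[OF _ bessel]) simp
  show "(\<Sum>n. (cmod (G n \<theta>\<^sub>2))\<^sup>2 * monom_norm_sq p n) \<le> (\<Sum>n. (cmod (b n))\<^sup>2 * monom_norm_sq p n)"
    by (rule suminf_le_const[OF summG bessel])
  define e where "e = (\<lambda>n. (A * B) ^ Suc p * (G n \<theta>\<^sub>2 * (A\<^sup>2) ^ n))"
  have e: "(\<lambda>n. e n * z ^ n) sums discrete_series \<epsilon> (Suc p) (k_tilde \<theta>\<^sub>1 ** a_tilde r ** k_tilde \<theta>\<^sub>2) g z"
    if "norm z < 1" for z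
    using discrete_series_kak_series[OF g b that, of \<epsilon> \<theta>\<^sub>1 \<theta>\<^sub>2 r]
    unfolding e_def G_eq b'_def A_def B_def .
  have ne: "cmod (e n) = cmod (G n \<theta>\<^sub>2)" for n
    by (simp add: e_def norm_mult norm_power nA nB)
  have summe: "summable (\<lambda>n. (cmod (e n))\<^sup>2 * monom_norm_sq p n)"
    using summG by (simp add: ne)
  have "H_inner (Suc p) f (discrete_series \<epsilon> (Suc p) (k_tilde \<theta>\<^sub>1 ** a_tilde r ** k_tilde \<theta>\<^sub>2) g) =
     (\<Sum>n. cnj (a n) * e n * of_real (monom_norm_sq p n))"
    by (rule H_inner_series[OF f e a summe])
  also have "\<dots> = (\<Sum>n. (A * B) ^ Suc p * ((cnj (a n) * of_real (monom_norm_sq p n) * G n \<theta>\<^sub>2) * cis (of_int j * \<theta>\<^sub>1) ^ n))"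
    by (simp only: e_def A2 mult_ac)
  also have "\<dots> = (A * B) ^ Suc p * (\<Sum>n. (cnj (a n) * of_real (monom_norm_sq p n) * G n \<theta>\<^sub>2) * cis (of_int j * \<theta>\<^sub>1) ^ n)"
  proof (rule suminf_mult, rule summable_norm_cancel)
    show "summable (\<lambda>n. cmod ((cnj (a n) * of_real (monom_norm_sq p n) * G n \<theta>\<^sub>2) * cis (of_int j * \<theta>\<^sub>1) ^ n))"
      using summable_weighted_product[OF a summG] by (simp add: norm_mult norm_power)
  qed
  finally show "cmod (H_inner (Suc p) f (discrete_series \<epsilon> (Suc p) (k_tilde \<theta>\<^sub>1 ** a_tilde r ** k_tilde \<theta>\<^sub>2) g)) =
      cmod (\<Sum>n. (cnj (a n) * of_real (monom_norm_sq p n) * G n \<theta>\<^sub>2) * cis (of_int j * \<theta>\<^sub>1) ^ n)"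
    by (simp only: norm_mult norm_power nA nB) simp
qed

theorem corollary4p3:
  fixes l :: nat and \<epsilon> :: series_sign and r :: real and f g :: "complex \<Rightarrow> complex"
  assumes "l \<ge> 1" and "r > 0" and "f \<in> H_space l" and "g \<in> H_space l"
  shows "sqrt (1 / (2 * pi)\<^sup>2 * (LBINT \<theta>\<^sub>2:{-pi..pi}. (LBINT \<theta>\<^sub>1:{-pi..pi}.
             (cmod (H_inner l f (discrete_series \<epsilon> l (k_tilde \<theta>\<^sub>1 ** a_tilde r ** k_tilde \<theta>\<^sub>2) g)))\<^sup>2)))
         \<le> inverse (cosh r) * H_norm l f * H_norm l g"
proof -
  obtain p where l: "l = Suc p" using \<open>l \<ge> 1\<close> by (cases l) auto
  obtain a where f: "\<And>z. norm z < 1 \<Longrightarrow> (\<lambda>n. a n * z ^ n) sums f z"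
    and a: "summable (\<lambda>n. (cmod (a n))\<^sup>2 * monom_norm_sq p n)"
    using H_space_series \<open>f \<in> H_space l\<close> unfolding l by blast
  obtain b where g: "\<And>z. norm z < 1 \<Longrightarrow> (\<lambda>n. b n * z ^ n) sums g z"
    and b: "summable (\<lambda>n. (cmod (b n))\<^sup>2 * monom_norm_sq p n)"
    using H_space_series \<open>g \<in> H_space l\<close> unfolding l by blast
  define h where "h = monom_norm_sq p"
  define Na Nb where "Na = (\<Sum>n. (cmod (a n))\<^sup>2 * h n)" and "Nb = (\<Sum>n. (cmod (b n))\<^sup>2 * h n)"
  define j where "j = - 2 * series_sgn \<epsilon>"
  have j: "j \<noteq> 0" by (cases \<epsilon>) (simp_all add: j_def)
  define G where "G = (\<lambda>n \<theta>. \<Sum>m. of_real (ds_coeff p r n m) * b m * cis (of_int j * \<theta>) ^ m)"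
  have G_summable: "summable (\<lambda>n. (cmod (G n \<theta>))\<^sup>2 * h n)" for \<theta>
    unfolding G_def h_def j_def by (rule kak_coefficient(1)[OF f a g b])
  have G_norm_le: "(\<Sum>n. (cmod (G n \<theta>))\<^sup>2 * h n) \<le> Nb" for \<theta>
    unfolding Nb_def G_def h_def j_def by (rule kak_coefficient(2)[OF f a g b])
  have coeff: "cmod (H_inner (Suc p) f (discrete_series \<epsilon> (Suc p) (k_tilde \<theta>\<^sub>1 ** a_tilde r ** k_tilde \<theta>) g)) =
      cmod (\<Sum>n. (cnj (a n) * of_real (h n) * G n \<theta>) * cis (of_int j * \<theta>\<^sub>1) ^ n)" for \<theta>\<^sub>1 \<theta>
    unfolding G_def h_def j_def by (rule kak_coefficient(3)[OF f a g b])
  have hpos: "h n > 0" for n by (simp add: h_def)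
  have Nb0: "Nb \<ge> 0" unfolding Nb_def h_def by (intro suminf_nonneg b) simp
  have Na0: "Na \<ge> 0" unfolding Na_def h_def by (intro suminf_nonneg a) simp
  define S where "S = (\<lambda>\<theta>. \<Sum>n. (cmod (a n) * h n * cmod (G n \<theta>))\<^sup>2)"
  \<comment> \<open>Parseval in the first angle, with the second one fixed.\<close>
  have inner: "(LBINT \<theta>\<^sub>1:{-pi..pi}. (cmod (H_inner l f (discrete_series \<epsilon> l (k_tilde \<theta>\<^sub>1 ** a_tilde r ** k_tilde \<theta>\<^sub>2) g)))\<^sup>2)
      = 2 * pi * S \<theta>\<^sub>2"
    and summS: "summable (\<lambda>n. (cmod (a n) * h n * cmod (G n \<theta>\<^sub>2))\<^sup>2)" for \<theta>\<^sub>2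
  proof -
    define q where "q = (\<lambda>n. cnj (a n) * of_real (h n) * G n \<theta>\<^sub>2)"
    have q: "summable (\<lambda>n. cmod (q n))"
      unfolding q_def h_def by (rule summable_weighted_product[OF a G_summable[of \<theta>\<^sub>2, unfolded h_def]])
    have nq: "cmod (q n) = cmod (a n) * h n * cmod (G n \<theta>\<^sub>2)" for n
      using hpos[of n] by (simp add: q_def norm_mult)
    note P = parseval(2)[OF j q, unfolded nq]
    show "summable (\<lambda>n. (cmod (a n) * h n * cmod (G n \<theta>\<^sub>2))\<^sup>2)"
      by (rule sums_summable[OF P])
    show "(LBINT \<theta>\<^sub>1:{-pi..pi}. (cmod (H_inner l f (discrete_series \<epsilon> l (k_tilde \<theta>\<^sub>1 ** a_tilde r ** k_tilde \<theta>\<^sub>2) g)))\<^sup>2)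
      = 2 * pi * S \<theta>\<^sub>2"
      unfolding l coeff S_def sums_unique[OF P, symmetric] by (simp add: q_def)
  qed
  \<comment> \<open>Parseval in the second angle, for each n separately. The entrywise bound
    \<open>ds_coeff_bound\<close> enters here, and with it the factor 1 / \<open>cosh r\<close>
    squared.\<close>
  have G_int: "set_integrable lborel {-pi..pi} (\<lambda>\<theta>. (cmod (G n \<theta>))\<^sup>2)"
    and G_le: "h n * (LBINT \<theta>:{-pi..pi}. (cmod (G n \<theta>))\<^sup>2) \<le> 2 * pi * (Nb / (cosh r)\<^sup>2)" for n
  proof -
    have s: "summable (\<lambda>m. cmod (of_real (ds_coeff p r n m) * b m))"
      using summable_ds_coeff_mult[OF b] by (simp add: norm_mult)
    show "set_integrable lborel {-pi..pi} (\<lambda>\<theta>. (cmod (G n \<theta>))\<^sup>2)"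
      unfolding G_def by (rule parseval(1)[OF j s])
    define I where "I = (LBINT \<theta>:{-pi..pi}. (cmod (G n \<theta>))\<^sup>2)"
    have I: "(\<lambda>m. (cmod (of_real (ds_coeff p r n m) * b m))\<^sup>2) sums (I / (2 * pi))"
      unfolding I_def G_def by (rule parseval(2)[OF j s])
    have I': "(\<lambda>m. h n * (cmod (of_real (ds_coeff p r n m) * b m))\<^sup>2) sums (h n * (I / (2 * pi)))"
      by (rule sums_mult[OF I])
    have le: "h n * (cmod (of_real (ds_coeff p r n m) * b m))\<^sup>2 \<le> (cmod (b m))\<^sup>2 * h m / (cosh r)\<^sup>2" for m
    proof -
      have "h n * (ds_coeff p r n m)\<^sup>2 * (cmod (b m))\<^sup>2 \<le> h m / (cosh r)\<^sup>2 * (cmod (b m))\<^sup>2"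
        using ds_coeff_bound[of p n r m] unfolding h_def by (intro mult_right_mono) auto
      thus ?thesis by (simp add: norm_mult power_mult_distrib mult_ac)
    qed
    have "h n * (I / (2 * pi)) \<le> (\<Sum>m. (cmod (b m))\<^sup>2 * h m / (cosh r)\<^sup>2)"
      unfolding sums_unique[OF I']
      by (intro suminf_le le sums_summable[OF I'] summable_divide) (use b in \<open>simp add: h_def\<close>)
    also have "\<dots> = Nb / (cosh r)\<^sup>2"
      unfolding Nb_def by (rule suminf_divide) (use b in \<open>simp add: h_def\<close>)
    finally show "h n * (LBINT \<theta>:{-pi..pi}. (cmod (G n \<theta>))\<^sup>2) \<le> 2 * pi * (Nb / (cosh r)\<^sup>2)"
      unfolding I_def[symmetric] by (simp add: field_simps)
  qed
  define s where "s = (\<lambda>K \<theta>. \<Sum>n<K. (cmod (a n) * h n)\<^sup>2 * (cmod (G n \<theta>))\<^sup>2)"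
  have s_int: "set_integrable lborel {-pi..pi} (s K)" for K
    unfolding s_def by (intro set_lebesgue_integral_sum(1) set_integrable_mult_right G_int)
  have s_lim: "(\<lambda>K. s K \<theta>) \<longlonglongrightarrow> S \<theta>" for \<theta>
    using summable_LIMSEQ[OF summS[of \<theta>]] by (simp only: s_def S_def power_mult_distrib)
  \<comment> \<open>This majorant serves only to integrate the series for \<open>S\<close> term by
    term, so the contraction bound \<open>G_norm_le\<close>, without decay in r, is enough.\<close>
  have s_bnd: "\<bar>s K \<theta>\<bar> \<le> Na * Nb" for K \<theta>
  proof -
    have "(cmod (a n) * h n)\<^sup>2 * (cmod (G n \<theta>))\<^sup>2 \<le> (cmod (a n))\<^sup>2 * h n * Nb" for n
    proof -
      have "(cmod (G n \<theta>))\<^sup>2 * h n \<le> (\<Sum>n. (cmod (G n \<theta>))\<^sup>2 * h n)"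
        using sum_le_suminf[OF G_summable[of \<theta>], of "{n}"] hpos by (simp add: less_imp_le)
      also have "\<dots> \<le> Nb"
        by (rule G_norm_le)
      finally have "(cmod (a n))\<^sup>2 * h n * ((cmod (G n \<theta>))\<^sup>2 * h n) \<le> (cmod (a n))\<^sup>2 * h n * Nb"
        using hpos[of n] by (intro mult_left_mono) auto
      thus ?thesis by (simp add: power2_eq_square mult_ac)
    qed
    hence "s K \<theta> \<le> (\<Sum>n<K. (cmod (a n))\<^sup>2 * h n * Nb)"
      unfolding s_def by (intro sum_mono)
    also have "\<dots> = (\<Sum>n<K. (cmod (a n))\<^sup>2 * h n) * Nb"
      by (simp add: sum_distrib_right)
    also have "\<dots> \<le> Na * Nb"
      unfolding Na_def using a by (intro mult_right_mono Nb0 sum_le_suminf) (auto simp: h_def)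
    finally have "s K \<theta> \<le> Na * Nb" .
    moreover have "s K \<theta> \<ge> 0" unfolding s_def by (intro sum_nonneg) auto
    ultimately show ?thesis by simp
  qed
  have "(LBINT \<theta>:{-pi..pi}. S \<theta>) \<le> 2 * pi * (Na * Nb / (cosh r)\<^sup>2)"
  proof (rule LIMSEQ_le_const2)
    show "(\<lambda>K. LBINT \<theta>:{-pi..pi}. s K \<theta>) \<longlonglongrightarrow> (LBINT \<theta>:{-pi..pi}. S \<theta>)"
      by (rule bounded_convergence_interval(2)[OF s_int s_lim s_bnd])
    have "(LBINT \<theta>:{-pi..pi}. s K \<theta>) \<le> 2 * pi * (Na * Nb / (cosh r)\<^sup>2)" for K
    proof -
      have "(LBINT \<theta>:{-pi..pi}. s K \<theta>) =
          (\<Sum>n<K. LBINT \<theta>:{-pi..pi}. (cmod (a n) * h n)\<^sup>2 * (cmod (G n \<theta>))\<^sup>2)"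
        unfolding s_def by (intro set_lebesgue_integral_sum(2) set_integrable_mult_right G_int)
      also have "\<dots> = (\<Sum>n<K. (cmod (a n))\<^sup>2 * h n * (h n * (LBINT \<theta>:{-pi..pi}. (cmod (G n \<theta>))\<^sup>2)))"
        by (simp add: power2_eq_square mult_ac)
      also have "\<dots> \<le> (\<Sum>n<K. (cmod (a n))\<^sup>2 * h n * (2 * pi * (Nb / (cosh r)\<^sup>2)))"
        using hpos by (intro sum_mono mult_left_mono G_le) (auto simp: less_imp_le)
      also have "\<dots> = (\<Sum>n<K. (cmod (a n))\<^sup>2 * h n) * (2 * pi * (Nb / (cosh r)\<^sup>2))"
        by (rule sum_distrib_right[symmetric])
      also have "\<dots> \<le> Na * (2 * pi * (Nb / (cosh r)\<^sup>2))"
        unfolding Na_def using a Nb0 by (intro mult_right_mono sum_le_suminf) (auto simp: h_def)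
      finally show ?thesis by (simp add: mult_ac)
    qed
    thus "\<exists>N. \<forall>K\<ge>N. (LBINT \<theta>:{-pi..pi}. s K \<theta>) \<le> 2 * pi * (Na * Nb / (cosh r)\<^sup>2)" by blast
  qed
  \<comment> \<open>Each use of Parseval has produced a factor 2 \<pi>; the normalisation of the
    double mean cancels both.\<close>
  hence "2 * pi * (LBINT \<theta>:{-pi..pi}. S \<theta>) \<le> 2 * pi * (2 * pi * (Na * Nb / (cosh r)\<^sup>2))"
    by (intro mult_left_mono) auto
  hence "1 / (2 * pi)\<^sup>2 * (2 * pi * (LBINT \<theta>:{-pi..pi}. S \<theta>)) \<le>
      1 / (2 * pi)\<^sup>2 * (2 * pi * (2 * pi * (Na * Nb / (cosh r)\<^sup>2)))"
    by (rule mult_left_mono) simp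
  also have "\<dots> = (inverse (cosh r))\<^sup>2 * Na * Nb"
    by (simp add: power2_eq_square field_simps)
  finally have "sqrt (1 / (2 * pi)\<^sup>2 * (2 * pi * (LBINT \<theta>:{-pi..pi}. S \<theta>))) \<le> sqrt ((inverse (cosh r))\<^sup>2 * Na * Nb)"
    by (rule real_sqrt_le_mono)
  also have "\<dots> = inverse (cosh r) * sqrt Na * sqrt Nb"
    by (simp add: real_sqrt_mult)
  also have "sqrt Na = H_norm l f"
    unfolding l Na_def h_def by (rule H_norm_series[OF f a, symmetric])
  also have "sqrt Nb = H_norm l g"
    unfolding l Nb_def h_def by (rule H_norm_series[OF g b, symmetric])
  finally show ?thesis
    unfolding inner by (simp only: set_integral_mult_right)
qed

end
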